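(* Each of the following two conditions is sufficient for the first strictly ascending ladder height $Z$ to be relatively stable: (C.I) $\displaystyle\lim_{x\to\infty}\frac{A(x)}{x\mu(x)}=\infty$; (C.II) $EX=0$ and $\displaystyle\lim_{x\to\infty}\frac{x\eta_+(x)}{m(x)}=0$.
   Context: Let $X,X_1,X_2,\dots$ be i.i.d. integer-valued random variables, $S_n=X_1+\dots+X_n$, $S_0=0$; the random walk is irreducible on $\mathbb Z$, $P[X\ge2]>0$, and $P[|X|>x]>0$ for all $x>0$. For (C.I) neither $E|X|<\infty$ nor recurrence of the walk is assumed; for (C.II) it is assumed that $EX^2=\infty$ (in addition to $EX=0$). $Z=S_\tau$ where $\tau=\inf\{n\ge1:S_n>0\}$. $Z$ is called relatively stable if there is a non-random sequence $B_n$ such that $(Z_1+\dots+Z_n)/B_n\to1$ in probability, where $Z_1,Z_2,\dots$ are i.i.d. copies of $Z$. For real $x\ge0$: $\mu_-(x)=P[X<-x]$, $\mu_+(x)=P[X>x]$, $\mu=\mu_++\mu_-$; $A(x)=\int_0^x[\mu_+(y)-\mu_-(y)]\,dy$; $\eta_\pm(x)=\int_x^\infty\mu_\pm(y)\,dy$, $\eta=\eta_++\eta_-$; $m(x)=\int_0^x\eta(s)\,ds$. *)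

theory Defs
  imports "HOL-Probability.Probability"
begin

definition iid :: "'a measure \<Rightarrow> (nat \<Rightarrow> 'a \<Rightarrow> int) \<Rightarrow> bool" where
  "iid M X \<longleftrightarrow>
     prob_space.indep_vars M (\<lambda>_. count_space UNIV) X UNIV \<and>
     (\<forall>n. distr M (count_space UNIV) (X n) = distr M (count_space UNIV) (X 0))"

text \<open>In a sequence \<open>X\<close> the entry \<open>X 0\<close> plays the role of the generic variable; the steps of
  the walk are \<open>X 1, X 2, \<dots>\<close>.\<close>

definition walk :: "(nat \<Rightarrow> 'a \<Rightarrow> int) \<Rightarrow> nat \<Rightarrow> 'a \<Rightarrow> int" where
  "walk X n \<omega> = (\<Sum>k=1..n. X k \<omega>)"

definition irreducible_walk :: "'a measure \<Rightarrow> (nat \<Rightarrow> 'a \<Rightarrow> int) \<Rightarrow> bool" where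
  "irreducible_walk M X \<longleftrightarrow>
     (\<forall>x y. \<exists>n. measure M {\<omega> \<in> space M. x + walk X n \<omega> = y} > 0)"

text \<open>The infimum of the empty set is \<open>\<infinity>\<close>.  On the event that the walk never becomes positive
  the ladder height is \<open>\<infinity>\<close> as well.  If that event had positive probability,
  the ladder height could not be relatively stable in the sense below.\<close>

definition ladder_time :: "(nat \<Rightarrow> 'a \<Rightarrow> int) \<Rightarrow> 'a \<Rightarrow> enat" where
  "ladder_time X \<omega> = (INF n\<in>{n. n \<ge> 1 \<and> walk X n \<omega> > 0}. enat n)"

definition ladder_height :: "(nat \<Rightarrow> 'a \<Rightarrow> int) \<Rightarrow> 'a \<Rightarrow> ereal" where
  "ladder_height X \<omega> =
     (case ladder_time X \<omega> of
        enat n \<Rightarrow> ereal (of_int (walk X n \<omega>))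
      | \<infinity> \<Rightarrow> \<infinity>)"

text \<open>The i.i.d. copies of \<open>Z\<close> are realised as the coordinates of the infinite product of the
  law of \<open>Z\<close>.\<close>

definition relatively_stable :: "'a measure \<Rightarrow> ('a \<Rightarrow> ereal) \<Rightarrow> bool" where
  "relatively_stable M Z \<longleftrightarrow>
     (let P = (\<Pi>\<^sub>M i\<in>(UNIV :: nat set). distr M borel Z) in
      \<exists>B :: nat \<Rightarrow> real. \<forall>\<epsilon>>0.
        (\<lambda>n. measure P {z \<in> space P. \<bar>(\<Sum>i<n. z i) / ereal (B n) - 1\<bar> > ereal \<epsilon>})
          \<longlonglongrightarrow> 0)"

definition mu_plus :: "'a measure \<Rightarrow> ('a \<Rightarrow> int) \<Rightarrow> real \<Rightarrow> real" where
  "mu_plus M Y x = measure M {\<omega> \<in> space M. real_of_int (Y \<omega>) > x}"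

definition mu_minus :: "'a measure \<Rightarrow> ('a \<Rightarrow> int) \<Rightarrow> real \<Rightarrow> real" where
  "mu_minus M Y x = measure M {\<omega> \<in> space M. real_of_int (Y \<omega>) < - x}"

definition mu :: "'a measure \<Rightarrow> ('a \<Rightarrow> int) \<Rightarrow> real \<Rightarrow> real" where
  "mu M Y x = mu_plus M Y x + mu_minus M Y x"

definition A_fun :: "'a measure \<Rightarrow> ('a \<Rightarrow> int) \<Rightarrow> real \<Rightarrow> real" where
  "A_fun M Y x = (LBINT y:{0..x}. mu_plus M Y y - mu_minus M Y y)"

text \<open>The integrals over \<open>{x..}\<close> converge when \<open>Y\<close> is integrable; otherwise the Bochner integral
  of a non-integrable tail would be the junk value \<open>0\<close>.\<close>

definition eta_plus :: "'a measure \<Rightarrow> ('a \<Rightarrow> int) \<Rightarrow> real \<Rightarrow> real" where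
  "eta_plus M Y x = (LBINT y:{x..}. mu_plus M Y y)"

definition eta_minus :: "'a measure \<Rightarrow> ('a \<Rightarrow> int) \<Rightarrow> real \<Rightarrow> real" where
  "eta_minus M Y x = (LBINT y:{x..}. mu_minus M Y y)"

definition eta :: "'a measure \<Rightarrow> ('a \<Rightarrow> int) \<Rightarrow> real \<Rightarrow> real" where
  "eta M Y x = eta_plus M Y x + eta_minus M Y x"

definition m_fun :: "'a measure \<Rightarrow> ('a \<Rightarrow> int) \<Rightarrow> real \<Rightarrow> real" where
  "m_fun M Y x = (LBINT s:{0..x}. eta M Y s)"

definition cond_CI :: "'a measure \<Rightarrow> ('a \<Rightarrow> int) \<Rightarrow> bool" where
  "cond_CI M Y \<longleftrightarrow> filterlim (\<lambda>x. A_fun M Y x / (x * mu M Y x)) at_top at_top"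

definition cond_CII :: "'a measure \<Rightarrow> ('a \<Rightarrow> int) \<Rightarrow> bool" where
  "cond_CII M Y \<longleftrightarrow>
     integrable M (\<lambda>\<omega>. real_of_int (Y \<omega>)) \<and>
     (LINT \<omega>|M. real_of_int (Y \<omega>)) = 0 \<and>
     ((\<lambda>x. x * eta_plus M Y x / m_fun M Y x) \<longlongrightarrow> 0) at_top"

end

(*
  Let H(x) be the probability that the first passage of the walk above the level x lands above 2x
  (or never happens), let q(j) = P[Z > j] and L(m) = q(0) + ... + q(m).  Splitting a passage at the
  first ladder point gives a renewal inequality for H, which yields (m + 1) q(2m) <= H(m) L(m).
  So if H(x) -> 0, then j q(j) / L(j) -> 0, and the weak law for truncated sums shows that Z is
  relatively stable; this also excludes a positive probability of Z = infinity.

  For H(x) -> 0, let psi = E[exp(t X); X <= x] with t = d / x.  Up to the first step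
  larger than x, exp(t S_n) psi^(-n) is a martingale; when the walk passes x before such a step,
  S_n <= 2x.  Optional stopping gives 1 - H(x) >= exp(-2d) as soon as psi > 1, and d is arbitrary.
  Both (C.I) and (C.II) yield psi > 1 for every fixed d and large x, by elementary pointwise lower
  bounds of exp: one involving the truncation of X at x, whose mean is A(x), and one involving the
  truncated square of X, whose mean is m(x).
*)

theory Submission
  imports Defs
begin

section \<open>First passage above a level\<close>

text \<open>A heavy tail of Z forces overshoots: of order (m + 1) / L(m) ladder points fall into
  [0, m], and each is followed with probability q(2m) by a ladder step that lands above 2m. The
  renewal inequality turns this count into a comparison with a linear function of the level. The
  scale d / x of the exponent is forced from two sides. The factor exp(2d) has to be close to 1, so
  d is small; but with d fixed the gain in the truncated exponential moment, of order d A(x) / x or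
  d^2 m(x) / x^2, has to beat the loss caused by discarding large steps, of order mu(x) or
  eta_+(x/2) / x. The quotients of gain and loss are those of (C.I) and (C.II), so every fixed d
  works for large x. Passage probabilities are defined by recursion on the step law. Splitting at a
  ladder point and optional stopping thereby become inductions on the number of steps, and path
  space enters only when the law of Z is identified.\<close>

text \<open>\<open>passage D x A n y\<close> is the probability that the walk with step law \<open>D\<close> started at \<open>y\<close>
  enters \<open>{x<..}\<close> within \<open>n\<close> steps and does so at a point of \<open>A\<close>; the starting point is not
  tested.\<close>

primrec passage :: "int measure \<Rightarrow> int \<Rightarrow> int set \<Rightarrow> nat \<Rightarrow> int \<Rightarrow> real" where
  "passage D x A 0 y = 0"
| "passage D x A (Suc n) y =
     (\<integral>k. (if x < y + k then indicator A (y + k) else passage D x A n (y + k)) \<partial>D)"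

text \<open>With the discrete sigma-algebra every function is measurable, so boundedness alone gives
  integrability.\<close>

locale step_law = prob_space D for D :: "int measure" +
  assumes sets_D [measurable_cong]: "sets D = sets (count_space UNIV)"
begin

lemma space_D [simp]: "space D = UNIV"
  using sets_eq_imp_space_eq[OF sets_D] by simp

lemma measurable_D: "f \<in> measurable D N \<longleftrightarrow> f \<in> UNIV \<rightarrow> space N"
  by (simp add: measurable_cong_sets[OF sets_D refl])

lemma integrable_bounded:
  fixes f :: "int \<Rightarrow> real"
  assumes "\<And>k. \<bar>f k\<bar> \<le> B"
  shows "integrable D f"
  by (rule integrable_const_bound[where B = B]) (use assms in \<open>auto simp: measurable_D\<close>)

lemma passage_bounds: "0 \<le> passage D x A n y \<and> passage D x A n y \<le> 1"
proof (induction n arbitrary: y)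
  case (Suc n)
  have "\<bar>if x < y + k then indicator A (y + k) else passage D x A n (y + k)\<bar> \<le> 1" for k
    using Suc[of "y + k"] by (auto simp: indicator_def)
  then have "integrable D (\<lambda>k. if x < y + k then indicator A (y + k) else passage D x A n (y + k))"
    by (rule integrable_bounded)
  then show ?case
    using Suc by (auto intro!: integral_nonneg integral_le_const simp: indicator_def)
qed simp

lemmas passage_nonneg = passage_bounds[THEN conjunct1]
  and passage_le_1 = passage_bounds[THEN conjunct2]

lemma integrable_passage_step [simp]:
  "integrable D (\<lambda>k. if x < y + k then indicator A (y + k) else passage D x A n (y + k))"
  by (rule integrable_bounded[where B = 1]) (auto simp: indicator_def passage_nonneg passage_le_1)

lemma passage_mono_Suc: "passage D x A n y \<le> passage D x A (Suc n) y"
proof (induction n arbitrary: y)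
  case 0
  then show ?case using passage_nonneg[of x A "Suc 0" y] by (simp only: passage.simps)
next
  case (Suc n)
  have "passage D x A (Suc n) y =
      (\<integral>k. (if x < y + k then indicator A (y + k) else passage D x A n (y + k)) \<partial>D)"
    by simp
  also have "\<dots> \<le> (\<integral>k. (if x < y + k then indicator A (y + k) else passage D x A (Suc n) (y + k)) \<partial>D)"
    using Suc by (intro integral_mono integrable_passage_step) (auto simp del: passage.simps)
  finally show ?case by (simp only: passage.simps)
qed

lemma incseq_passage: "incseq (\<lambda>n. passage D x A n y)"
  by (rule incseq_SucI) (rule passage_mono_Suc)

lemma passage_shift: "passage D (x + c) ((\<lambda>a. a + c) ` A) n (y + c) = passage D x A n y"
proof (induction n arbitrary: y)
  case (Suc n)
  have shift: "y + c + k = y + k + c" for k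
    by simp
  have "passage D (x + c) ((\<lambda>a. a + c) ` A) (Suc n) (y + c) =
    (\<integral>k. (if x < y + k then indicator ((\<lambda>a. a + c) ` A) (y + k + c)
      else passage D (x + c) ((\<lambda>a. a + c) ` A) n ((y + k) + c)) \<partial>D)"
    by (simp only: passage.simps shift add_less_cancel_right)
  also have "\<dots> = passage D x A (Suc n) y"
    unfolding Suc passage.simps
    by (intro Bochner_Integration.integral_cong)
       (auto simp: indicator_def image_iff algebra_simps)
  finally show ?case .
qed simp

lemma passage_Un:
  assumes "A \<inter> B = {}"
  shows "passage D x (A \<union> B) n y = passage D x A n y + passage D x B n y"
proof (induction n arbitrary: y)
  case (Suc n)
  have "passage D x A (Suc n) y + passage D x B (Suc n) y =
    (\<integral>k. (if x < y + k then indicator A (y + k) else passage D x A n (y + k)) +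
          (if x < y + k then indicator B (y + k) else passage D x B n (y + k)) \<partial>D)"
    by (simp add: Bochner_Integration.integral_add)
  also have "\<dots> = passage D x (A \<union> B) (Suc n) y"
    unfolding passage.simps using assms Suc
    by (intro Bochner_Integration.integral_cong) (auto simp: indicator_def)
  finally show ?case by simp
qed simp

lemma passage_below: "A \<subseteq> {..x} \<Longrightarrow> passage D x A n y = 0"
proof (induction n arbitrary: y)
  case (Suc n)
  then have "(if x < y + k then indicator A (y + k) else passage D x A n (y + k)) = (0::real)" for k
    by (auto simp: indicator_def)
  then show ?case by simp
qed simp

text \<open>Only the start 0 is kept: a restart from another point is moved to 0 by
  \<open>passage_shift\<close>.\<close>

definition passage_lim :: "int \<Rightarrow> int set \<Rightarrow> real" where
  "passage_lim x A = (SUP n. passage D x A n 0)"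

lemma bdd_passage: "bdd_above (range (\<lambda>n. passage D x A n y))"
  by (rule bdd_aboveI[where M = 1]) (auto simp: passage_le_1)

lemma passage_le_lim: "passage D x A n 0 \<le> passage_lim x A"
  unfolding passage_lim_def by (rule cSUP_upper) (auto simp: bdd_passage)

lemma LIMSEQ_passage: "(\<lambda>n. passage D x A n 0) \<longlonglongrightarrow> passage_lim x A"
  unfolding passage_lim_def by (rule LIMSEQ_incseq_SUP[OF bdd_passage incseq_passage])

lemma passage_lim_bounds: "0 \<le> passage_lim x A" "passage_lim x A \<le> 1"
  using LIMSEQ_le_const[OF LIMSEQ_passage] LIMSEQ_le_const2[OF LIMSEQ_passage]
    passage_nonneg passage_le_1 by blast+

lemma passage_lim_Un:
  "A \<inter> B = {} \<Longrightarrow> passage_lim x (A \<union> B) = passage_lim x A + passage_lim x B"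
  using tendsto_add[OF LIMSEQ_passage[of x A] LIMSEQ_passage[of x B]]
    LIMSEQ_passage[of x "A \<union> B"]
  by (simp add: passage_Un LIMSEQ_unique)

text \<open>The path is cut at its first positive value z. From z <= x it still has to pass x, which
  after translation is level x - z with the same window length t. The equality becomes an inequality
  because the steps left after z are replaced by an infinite horizon. The assumption
  \<open>y \<le> 0\<close> says that no ladder point has been met yet, which the induction
  preserves.\<close>

lemma passage_first_ladder:
  fixes x t :: nat
  assumes "y \<le> 0"
  shows "passage D (int x) {..int (x + t)} n y \<le>
    (\<Sum>z=1..x. passage D 0 {int z} n y * passage_lim (int (x - z)) {..int (x - z + t)})
      + passage D 0 {int x<..int (x + t)} n y"
  using assms
proof (induction n arbitrary: y)
  case (Suc n)
  let ?g = "\<lambda>z. passage_lim (int (x - z)) {..int (x - z + t)}"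
  let ?s = "\<lambda>x A k. if x < y + k then indicator A (y + k) else passage D x A n (y + k)"
  have le: "?s (int x) {..int (x + t)} k \<le>
      (\<Sum>z=1..x. ?s 0 {int z} k * ?g z) + ?s 0 {int x<..int (x + t)} k" for k
  proof -
    define w where "w = y + k"
    consider "w \<le> 0" | "0 < w" "w \<le> int x" | "int x < w" by linarith
    then show ?thesis
    proof cases
      case 1
      then show ?thesis using Suc.IH[of w] by (simp add: w_def)
    next
      \<comment> \<open>The first step reaches the ladder point w in {1..x}; the sum over z
        collapses to its term z = \<open>nat w\<close>.\<close>
      case 2
      have "passage D (int x) {..int (x + t)} n w =
          passage D (int x - w) {..int (x + t) - w} n 0"
      proof -
        have "(\<lambda>a. a + w) ` {..int (x + t) - w} = {..int (x + t)}"
          by (auto simp: image_iff intro!: bexI[of _ "_ - w"])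
        then show ?thesis
          using passage_shift[of "int x - w" w "{..int (x + t) - w}" n 0] by simp
      qed
      also have "\<dots> = passage D (int (x - nat w)) {..int (x - nat w + t)} n 0"
        using 2 by (simp add: of_nat_diff algebra_simps)
      also have "\<dots> \<le> ?g (nat w)"
        by (rule passage_le_lim)
      also have "\<dots> = (\<Sum>z=1..x. if z = nat w then ?g z else 0)"
        using 2 by (subst sum.delta) auto
      also have "\<dots> = (\<Sum>z=1..x. ?s 0 {int z} k * ?g z)"
        using 2 by (intro sum.cong) (auto simp: w_def indicator_def)
      finally show ?thesis
        using 2 by (simp add: w_def)
    next
      \<comment> \<open>The ladder point itself lies above x, so the last term alone gives the
        bound.\<close>
      case 3
      have "0 \<le> (\<Sum>z=1..x. ?s 0 {int z} k * ?g z)"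
        by (intro sum_nonneg mult_nonneg_nonneg) (auto simp: passage_lim_bounds passage_nonneg)
      then show ?thesis using 3 by (auto simp: w_def indicator_def)
    qed
  qed
  have "passage D (int x) {..int (x + t)} (Suc n) y \<le>
      (\<integral>k. (\<Sum>z=1..x. ?s 0 {int z} k * ?g z) + ?s 0 {int x<..int (x + t)} k \<partial>D)"
    unfolding passage.simps using le
    by (intro integral_mono Bochner_Integration.integrable_add Bochner_Integration.integrable_sum
        integrable_mult_left integrable_passage_step) auto
  also have "\<dots> = (\<Sum>z=1..x. passage D 0 {int z} (Suc n) y * ?g z)
      + passage D 0 {int x<..int (x + t)} (Suc n) y"
    by (subst Bochner_Integration.integral_add)
      (auto simp: Bochner_Integration.integral_sum intro!: Bochner_Integration.integrable_sum
        integrable_mult_left integrable_passage_step simp del: of_nat_add)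
  finally show ?case .
qed simp

end

section \<open>The renewal inequality and its linear comparison function\<close>

text \<open>The increment at z is contained in \<open>Q j\<close> for each j from z to x, that is, x
  - z + 1 times.\<close>

lemma sum_telescope_convolution:
  fixes Q :: "nat \<Rightarrow> real"
  assumes "Q 0 = 0"
  shows "(\<Sum>z=1..x. (Q z - Q (z - 1)) * (real (x - z) + 1)) = (\<Sum>j\<le>x. Q j)"
proof (induction x)
  case (Suc x)
  have tel: "(\<Sum>z=1..n. Q z - Q (z - 1)) = Q n" for n
    by (induction n) (auto simp: assms)
  have "(\<Sum>z=1..Suc x. (Q z - Q (z - 1)) * (real (Suc x - z) + 1)) =
      (\<Sum>z=1..x. (Q z - Q (z - 1)) * (real (x - z) + 1) + (Q z - Q (z - 1)))
        + (Q (Suc x) - Q x)"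
    by (simp add: Suc_diff_le algebra_simps)
  also have "\<dots> = (\<Sum>j\<le>Suc x. Q j)"
    using Suc tel[of x] by (simp add: sum.distrib)
  finally show ?case .
qed (simp add: assms)

text \<open>The function r (x + 1) / l is a subsolution on x <= m: r is the smallest forcing term
  there, and by the convolution identity the requirement reduces to sum over j <= x of (1 - Q j) <=
  l. Strong induction carries the comparison to x = m.\<close>

lemma renewal_lower_bound:
  fixes Q H :: "nat \<Rightarrow> real"
  assumes Q0: "Q 0 = 0" and Q: "mono Q" and Q1: "\<And>j. Q j \<le> 1"
    and H: "\<And>x. (\<Sum>z=1..x. (Q z - Q (z - 1)) * H (x - z)) + (1 - Q (x + t)) \<le> H x"
  shows "(real m + 1) * (1 - Q (m + t)) \<le> H m * (\<Sum>j\<le>m. 1 - Q j)"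
proof -
  define r where "r = 1 - Q (m + t)"
  define l where "l = (\<Sum>j\<le>m. 1 - Q j)"
  have r: "0 \<le> r" using Q1 by (simp add: r_def)
  have l1: "1 \<le> l"
    unfolding l_def using Q0 Q1 member_le_sum[of 0 "{..m}" "\<lambda>j. 1 - Q j"] by simp
  have "r * (real x + 1) / l \<le> H x" if "x \<le> m" for x
    using that
  proof (induction x rule: less_induct)
    case (less x)
    have "(\<Sum>j\<le>x. 1 - Q j) \<le> l"
      unfolding l_def using less.prems Q1 by (intro sum_mono2) auto
    then have "real x + 1 - (\<Sum>j\<le>x. Q j) \<le> l"
      by (simp add: sum_subtractf)
    then have "(real x + 1) / l \<le> ((\<Sum>j\<le>x. Q j) + l) / l"
      using l1 by (intro divide_right_mono) auto
    then have "(real x + 1) / l \<le> (\<Sum>j\<le>x. Q j) / l + 1"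
      using l1 by (simp add: add_divide_distrib)
    then have "r * (real x + 1) / l \<le> r * ((\<Sum>j\<le>x. Q j) / l + 1)"
      using mult_left_mono[OF _ r] by fastforce
    also have "(\<Sum>j\<le>x. Q j) = (\<Sum>z=1..x. (Q z - Q (z - 1)) * (real (x - z) + 1))"
      using sum_telescope_convolution[of Q, OF Q0] by simp
    also have "r * ((\<Sum>z=1..x. (Q z - Q (z - 1)) * (real (x - z) + 1)) / l + 1) =
        (\<Sum>z=1..x. (Q z - Q (z - 1)) * (r * (real (x - z) + 1) / l)) + r"
      by (simp add: sum_distrib_left sum_divide_distrib algebra_simps)
    also have "\<dots> \<le> (\<Sum>z=1..x. (Q z - Q (z - 1)) * H (x - z)) + (1 - Q (x + t))"
    proof (intro add_mono sum_mono mult_left_mono)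
      fix z assume z: "z \<in> {1..x}"
      then show "r * (real (x - z) + 1) / l \<le> H (x - z)"
        using less.IH[of "x - z"] less.prems by auto
      show "0 \<le> Q z - Q (z - 1)"
        using Q by (simp add: mono_def)
    next
      show "r \<le> 1 - Q (x + t)"
        using less.prems Q by (simp add: r_def mono_def)
    qed
    also have "\<dots> \<le> H x" by (rule H)
    finally show ?case .
  qed
  from this[of m] l1 show ?thesis
    by (simp add: r_def l_def field_simps)
qed

section \<open>Overshoot probabilities: renewal inequality and exponential bound\<close>

context step_law
begin

definition ladder_cdf :: "nat \<Rightarrow> real" where
  "ladder_cdf j = passage_lim 0 {..int j}"

text \<open>A complement, so that never passing x counts too. The window t is separate from x
  because the renewal inequality relates different levels with one window.\<close>

definition overshoot :: "nat \<Rightarrow> nat \<Rightarrow> real" where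
  "overshoot t x = 1 - passage_lim (int x) {..int (x + t)}"

lemma ladder_cdf_0: "ladder_cdf 0 = 0"
  by (simp add: ladder_cdf_def passage_lim_def passage_below)

lemma ladder_cdf_diff:
  assumes "i \<le> j"
  shows "passage_lim 0 {int i<..int j} = ladder_cdf j - ladder_cdf i"
proof -
  have "{..int j} = {..int i} \<union> {int i<..int j}" using assms by auto
  moreover have "{..int i} \<inter> {int i<..int j} = {}" by auto
  ultimately show ?thesis unfolding ladder_cdf_def by (metis add_diff_cancel_left' passage_lim_Un)
qed

lemma mono_ladder_cdf: "mono ladder_cdf"
  by (rule monoI) (use ladder_cdf_diff passage_lim_bounds in \<open>smt (verit)\<close>)

lemma ladder_cdf_le_1: "ladder_cdf j \<le> 1"
  by (simp add: ladder_cdf_def passage_lim_bounds)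

text \<open>This is the complement of \<open>passage_first_ladder\<close> in the limit: the ladder
  masses up to x telescope to \<open>ladder_cdf x\<close>, which replaces each passage probability
  by one minus it.\<close>

lemma overshoot_renewal:
  "(\<Sum>z=1..x. (ladder_cdf z - ladder_cdf (z - 1)) * overshoot t (x - z)) + (1 - ladder_cdf (x + t))
     \<le> overshoot t x"
proof -
  let ?g = "\<lambda>z. passage_lim (int (x - z)) {..int (x - z + t)}"
  have "passage_lim (int x) {..int (x + t)} \<le>
      (\<Sum>z=1..x. passage_lim 0 {int z} * ?g z) + passage_lim 0 {int x<..int (x + t)}"
  proof (rule LIMSEQ_le[OF LIMSEQ_passage])
    show "(\<lambda>n. (\<Sum>z=1..x. passage D 0 {int z} n 0 * ?g z) + passage D 0 {int x<..int (x + t)} n 0)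
      \<longlonglongrightarrow> (\<Sum>z=1..x. passage_lim 0 {int z} * ?g z) + passage_lim 0 {int x<..int (x + t)}"
      by (intro tendsto_intros LIMSEQ_passage)
  qed (use passage_first_ladder[of 0] in blast)
  moreover have "passage_lim 0 {int z} = ladder_cdf z - ladder_cdf (z - 1)" if "z \<ge> 1" for z
  proof -
    have "{int z} = {int (z - 1)<..int z}" using that by auto
    then show ?thesis using ladder_cdf_diff[of "z - 1" z] by simp
  qed
  ultimately have *: "passage_lim (int x) {..int (x + t)} \<le>
      (\<Sum>z=1..x. (ladder_cdf z - ladder_cdf (z - 1)) * ?g z) + (ladder_cdf (x + t) - ladder_cdf x)"
    using ladder_cdf_diff[of x "x + t"] by (simp del: of_nat_add)
  have tel: "(\<Sum>z=1..n. ladder_cdf z - ladder_cdf (z - 1)) = ladder_cdf n" for n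
    by (induction n) (auto simp: ladder_cdf_0)
  have "(\<Sum>z=1..x. (ladder_cdf z - ladder_cdf (z - 1)) * overshoot t (x - z)) =
      ladder_cdf x - (\<Sum>z=1..x. (ladder_cdf z - ladder_cdf (z - 1)) * ?g z)"
    unfolding overshoot_def right_diff_distrib sum_subtractf using tel[of x] by simp
  with * show ?thesis by (simp add: overshoot_def)
qed

text \<open>This is optional stopping of \<open>exp (\<theta> S) / \<psi> ^ n\<close> in the form of an induction on the first step.\<close>

lemma exp_passage:
  fixes \<theta> :: real and x :: nat
  assumes "0 \<le> \<theta>" and \<psi>: "\<psi> = (\<integral>k. indicator {..int x} k * exp (\<theta> * k) \<partial>D)" "1 \<le> \<psi>"
    and "y \<le> int x"
  shows "exp (\<theta> * y) \<le> exp (2 * \<theta> * x) * passage D (int x) {..int (x + x)} n y + exp (\<theta> * x) / \<psi> ^ n"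
  using assms(4)
proof (induction n arbitrary: y)
  case 0
  then have "real_of_int y \<le> real x" by linarith
  then show ?case using assms(1) by (simp add: mult_left_mono)
next
  case (Suc n)
  let ?p = "passage D (int x) {..int (x + x)}"
  let ?s = "\<lambda>k. if int x < y + k then indicator {..int (x + x)} (y + k) else ?p n (y + k)"
  have pt: "exp (\<theta> * y) * (indicator {..int x} k * exp (\<theta> * k)) \<le>
      exp (2 * \<theta> * x) * ?s k + exp (\<theta> * x) / \<psi> ^ n" for k
  proof -
    define w where "w = y + k"
    have e: "exp (\<theta> * y) * exp (\<theta> * k) = exp (\<theta> * w)"
      by (simp add: w_def algebra_simps flip: exp_add)
    have pos: "0 \<le> exp (2 * \<theta> * x) * ?s k" "0 \<le> exp (\<theta> * x) / \<psi> ^ n"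
      using \<psi>(2) by (auto simp: passage_nonneg)
    show ?thesis
    \<comment> \<open>A step above x contributes 0 on the left, so there the right side only has to
      be nonnegative.\<close>
    proof (cases "k \<le> int x")
      case False
      then show ?thesis using pos by simp
    next
      case True
      show ?thesis
      proof (cases "int x < w")
        case T: True
        have w2: "w \<le> int (x + x)" using True Suc.prems by (simp add: w_def)
        then have "real_of_int w \<le> 2 * real x" by linarith
        then have "exp (\<theta> * w) \<le> exp (2 * \<theta> * x)"
          using mult_left_mono[of "real_of_int w" "2 * real x" \<theta>] assms(1) by simp
        then have "exp (\<theta> * w) \<le> exp (2 * \<theta> * x) + exp (\<theta> * x) / \<psi> ^ n"
          using pos(2) by linarith
        moreover have "?s k = 1" using T w2 by (simp add: w_def)
        ultimately show ?thesis using True e pos(2) by simp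
      next
        case False
        then show ?thesis using Suc.IH[of w] True e by (simp add: w_def)
      qed
    qed
  qed
  have int1: "integrable D (\<lambda>k. indicator {..int x} k * exp (\<theta> * k))"
  proof (rule integrable_bounded[where B = "exp (\<theta> * x)"])
    fix k :: int
    have "k \<le> int x \<Longrightarrow> real_of_int k \<le> real x" by linarith
    then show "\<bar>indicator {..int x} k * exp (\<theta> * k)\<bar> \<le> exp (\<theta> * x)"
      using assms(1) by (auto simp: indicator_def mult_left_mono)
  qed
  have "exp (\<theta> * y) * \<psi> = (\<integral>k. exp (\<theta> * y) * (indicator {..int x} k * exp (\<theta> * k)) \<partial>D)"
    using int1 by (simp add: \<psi>(1))
  also have "\<dots> \<le> (\<integral>k. exp (2 * \<theta> * x) * ?s k + exp (\<theta> * x) / \<psi> ^ n \<partial>D)"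
    using pt int1 by (intro integral_mono Bochner_Integration.integrable_add
      integrable_mult_right integrable_passage_step) auto
  also have "\<dots> = exp (2 * \<theta> * x) * ?p (Suc n) y + exp (\<theta> * x) / \<psi> ^ n"
    by (subst Bochner_Integration.integral_add)
      (auto simp: prob_space[simplified] simp del: of_nat_add)
  finally have "exp (\<theta> * y) \<le> exp (2 * \<theta> * x) * ?p (Suc n) y / \<psi> + exp (\<theta> * x) / \<psi> ^ Suc n"
    using \<psi>(2) by (simp add: field_simps del: passage.simps)
  \<comment> \<open>Since \<psi> >= 1 the division may be dropped from the passage term; in the
    remainder it is kept and supplies the next power.\<close>
  also have "exp (2 * \<theta> * x) * ?p (Suc n) y / \<psi> \<le> exp (2 * \<theta> * x) * ?p (Suc n) y"
    using \<psi>(2) divide_left_mono[of 1 \<psi> "exp (2 * \<theta> * x) * ?p (Suc n) y"]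
      passage_nonneg[of "int x" "{..int (x + x)}" "Suc n" y]
    by (simp del: passage.simps)
  finally show ?case by simp
qed

text \<open>Strictness of 1 < \<psi> makes the remainder exp(\<theta> x) / \<psi>^n vanish as n
  grows; the start y = 0 makes the left side 1.\<close>

lemma overshoot_le:
  fixes \<theta> :: real and x :: nat
  assumes "0 \<le> \<theta>" "1 < (\<integral>k. indicator {..int x} k * exp (\<theta> * k) \<partial>D)"
  shows "overshoot x x \<le> 1 - exp (- (2 * \<theta> * x))"
proof -
  define \<psi> where "\<psi> = (\<integral>k. indicator {..int x} k * exp (\<theta> * real_of_int k) \<partial>D)"
  have "1 \<le> exp (2 * \<theta> * x) * passage_lim (int x) {..int (x + x)} + exp (\<theta> * x) * 0"
  proof (rule LIMSEQ_le_const)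
    have "(\<lambda>n. inverse (\<psi> ^ n)) \<longlonglongrightarrow> 0"
      using assms(2) LIMSEQ_inverse_realpow_zero[of \<psi>] by (simp add: \<psi>_def)
    then show "(\<lambda>n. exp (2 * \<theta> * x) * passage D (int x) {..int (x + x)} n 0 + exp (\<theta> * x) * inverse (\<psi> ^ n))
       \<longlonglongrightarrow> exp (2 * \<theta> * x) * passage_lim (int x) {..int (x + x)} + exp (\<theta> * x) * 0"
      by (intro tendsto_intros LIMSEQ_passage)
  qed (use exp_passage[OF assms(1) \<psi>_def, of 0] assms(2) in \<open>auto simp: \<psi>_def divide_inverse\<close>)
  then show ?thesis
    by (simp add: overshoot_def exp_minus field_simps)
qed

end

section \<open>Relative stability from the tail\<close>

text \<open>Off-diagonal products vanish by independence and centring; the bound K makes all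
  products integrable.\<close>

lemma sum_second_moment_iid:
  fixes N :: "'a measure" and Y :: "'a \<Rightarrow> real" and n :: nat
  assumes "prob_space N" and Y [measurable]: "Y \<in> borel_measurable N"
    and bound: "\<And>z. z \<in> space N \<Longrightarrow> \<bar>Y z\<bar> \<le> K" and mean: "(\<integral>z. Y z \<partial>N) = 0"
  shows "(\<integral>z. (\<Sum>i<n. Y (z i))\<^sup>2 \<partial>(\<Pi>\<^sub>M i\<in>(UNIV::nat set). N)) = real n * (\<integral>z. (Y z)\<^sup>2 \<partial>N)"
proof -
  interpret N: prob_space N by fact
  interpret P: product_prob_space "\<lambda>_::nat. N" UNIV ..
  let ?P = "\<Pi>\<^sub>M i\<in>(UNIV::nat set). N"
  have [measurable]: "(\<lambda>z. Y (z i)) \<in> borel_measurable ?P" for i by measurable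
  have comp: "distr ?P N (\<lambda>z. z i) = N" for i
    by (rule P.PiM_component) simp
  have sp: "z i \<in> space N" if "z \<in> space ?P" for z i
    using that by (auto simp: space_PiM)
  have K: "0 \<le> K" using bound N.not_empty by fastforce
  have "P.indep_vars (\<lambda>_. N) (\<lambda>i z. z i) UNIV"
  proof (subst P.indep_vars_iff_distr_eq_PiM')
    have "distr ?P ?P (\<lambda>x. \<lambda>i\<in>UNIV. x i) = ?P"
      by (simp add: restrict_UNIV distr_id)
    then show "distr ?P ?P (\<lambda>x. \<lambda>i\<in>UNIV. x i) = (\<Pi>\<^sub>M i\<in>UNIV. distr ?P N (\<lambda>z. z i))"
      by (simp add: comp)
  qed auto
  then have ind: "P.indep_vars (\<lambda>_. borel) (\<lambda>i z. Y (z i)) UNIV"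
    by (rule P.indep_vars_compose2) simp
  have int1: "integrable ?P (\<lambda>z. Y (z i))" for i
    by (rule P.integrable_const_bound[where B = K]) (auto simp: bound sp)
  have int2: "integrable ?P (\<lambda>z. Y (z i) * Y (z j))" for i j
    by (rule P.integrable_const_bound[where B = "K * K"])
      (auto simp: bound sp abs_mult K intro!: mult_mono)
  have E1: "(\<integral>z. f (z i) \<partial>?P) = (\<integral>z. f z \<partial>N)" if "f \<in> borel_measurable N" for f :: "'a \<Rightarrow> real" and i
    by (subst (2) comp[of i, symmetric], subst integral_distr) (use that in auto)
  have E: "(\<integral>z. Y (z i) * Y (z j) \<partial>?P) = (if i = j then \<integral>z. (Y z)\<^sup>2 \<partial>N else 0)" for i j
  proof (cases "i = j")
    case True
    then show ?thesis using E1[of "\<lambda>z. (Y z)\<^sup>2" i] by (simp add: power2_eq_square)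
  next
    case False
    have "(\<integral>z. (\<Prod>k\<in>{i, j}. Y (z k)) \<partial>?P) = (\<Prod>k\<in>{i, j}. \<integral>z. Y (z k) \<partial>?P)"
      by (rule P.indep_vars_lebesgue_integral) (auto intro!: int1 P.indep_vars_subset[OF ind])
    then show ?thesis using False E1[OF Y] mean by simp
  qed
  have "(\<integral>z. (\<Sum>i<n. Y (z i))\<^sup>2 \<partial>?P) = (\<integral>z. (\<Sum>i<n. \<Sum>j<n. Y (z i) * Y (z j)) \<partial>?P)"
    by (simp add: power2_eq_square sum_product)
  also have "\<dots> = (\<Sum>i<n. \<Sum>j<n. \<integral>z. Y (z i) * Y (z j) \<partial>?P)"
    by (simp add: Bochner_Integration.integral_sum int2)
  also have "\<dots> = real n * (\<integral>z. (Y z)\<^sup>2 \<partial>N)"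
    by (simp add: E)
  finally show ?thesis .
qed

text \<open>With finite summands and B nonzero, the extended operations in the definition of
  relative stability are the real ones.\<close>

lemma ereal_sum_truncation:
  fixes z :: "nat \<Rightarrow> ereal"
  assumes "\<And>i. i < n \<Longrightarrow> z i = ereal (f i)" "B \<noteq> 0"
    and "\<bar>(\<Sum>i<n. z i) / ereal B - 1\<bar> > ereal \<epsilon>"
  shows "\<bar>(\<Sum>i<n. f i) / B - 1\<bar> > \<epsilon>"
proof -
  have "(\<Sum>i<n. z i) = ereal (\<Sum>i<n. f i)"
    using assms(1) by simp
  then show ?thesis using assms(2,3) by (simp add: one_ereal_def)
qed

text \<open>Chebyshev's inequality for the truncated coordinates gives the second term. The first
  bounds the probability that some coordinate exceeds c; infinite coordinates belong to that
  event.\<close>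

lemma weak_law_truncated:
  fixes N :: "ereal measure" and c n :: nat and \<epsilon> :: real
  defines "q \<equiv> \<lambda>j::nat. measure N {ereal (real j)<..}"
  defines "L \<equiv> \<Sum>k\<le>c. q k"
  assumes "prob_space N" and sets [measurable_cong]: "sets N = sets borel"
    and AE: "AE z in N. z = \<infinity> \<or> (\<exists>k::nat. z = ereal (real k))"
    and "n > 0" "L > 0" "\<epsilon> > 0"
  shows "measure (\<Pi>\<^sub>M i\<in>(UNIV::nat set). N)
      {z \<in> space (\<Pi>\<^sub>M i\<in>(UNIV::nat set). N). \<bar>(\<Sum>i<n. z i) / ereal (real n * L) - 1\<bar> > ereal \<epsilon>}
    \<le> real n * q c + (\<Sum>k\<le>c. (2 * real k + 1) * q k) / (real n * L\<^sup>2) / \<epsilon>\<^sup>2"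
proof -
  interpret N: prob_space N by fact
  interpret P: product_prob_space "\<lambda>_::nat. N" UNIV ..
  let ?P = "\<Pi>\<^sub>M i\<in>(UNIV::nat set). N"
  have space_N [simp]: "space N = UNIV" using sets_eq_imp_space_eq[OF sets] by simp
  \<comment> \<open>On the support of N this is min(z, c + 1), with value c + 1 at infinity. As a
    sum of tail indicators it has moments that are sums of \<open>q\<close>.\<close>
  define Y :: "ereal \<Rightarrow> real" where "Y z = (\<Sum>k\<le>c. indicator {ereal (real k)<..} z)" for z
  have [measurable]: "Y \<in> borel_measurable N" unfolding Y_def by measurable
  have Y_bound: "0 \<le> Y z" "Y z \<le> c + 1" for z
    unfolding Y_def using sum_bounded_above[of "{..c}" "\<lambda>k. indicator {ereal (real k)<..} z :: real" 1]
    by (auto intro!: sum_nonneg simp: indicator_def)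
  have inti [simp]: "integrable N (\<lambda>z. a * indicator {ereal (real k)<..} z)" for k and a :: real
    by (rule N.integrable_const_bound[where B = "\<bar>a\<bar>"]) (auto simp: indicator_def)
  from inti[of 1] have inti1 [simp]: "integrable N (indicat_real {ereal (real k)<..})" for k
    by simp
  have EY: "(\<integral>z. Y z \<partial>N) = L"
    unfolding Y_def L_def by (subst Bochner_Integration.integral_sum) (auto simp: q_def)
  \<comment> \<open>The indicators are nested, so the square grows by (k + 1)^2 - k^2 = 2k + 1 with
    each new one.\<close>
  have sq: "(\<Sum>k\<le>c. indicator {ereal (real k)<..} z)\<^sup>2 =
     (\<Sum>k\<le>c. (2 * real k + 1) * indicator {ereal (real k)<..} z)" for z c
  proof (induction c)
    case (Suc c)
    show ?case
    proof (cases "ereal (real (Suc c)) < z")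
      case True
      then have *: "ereal (real k) < z" if "k \<le> Suc c" for k
        using that by (meson ereal_less_eq(3) of_nat_mono order_le_less_trans)
      then have "(\<Sum>k\<le>c. indicator {ereal (real k)<..} z) = real (Suc c)" by simp
      with Suc * show ?thesis by (simp add: power2_eq_square algebra_simps)
    qed (use Suc in simp)
  qed (auto simp: indicator_def)
  have EY2: "(\<integral>z. (Y z)\<^sup>2 \<partial>N) = (\<Sum>k\<le>c. (2 * real k + 1) * q k)"
    unfolding Y_def sq by (subst Bochner_Integration.integral_sum) (auto simp: q_def)
  define W where "W z = Y z - L" for z
  have [measurable]: "W \<in> borel_measurable N" unfolding W_def by measurable
  have intY: "integrable N Y"
    by (rule N.integrable_const_bound[where B = "c + 1"]) (use Y_bound in auto)
  have intY2: "integrable N (\<lambda>z. (Y z)\<^sup>2)"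
    by (rule N.integrable_const_bound[where B = "(c + 1)\<^sup>2"])
       (use Y_bound in \<open>auto intro!: power_mono\<close>)
  have EW: "(\<integral>z. W z \<partial>N) = 0"
    unfolding W_def using intY by (simp add: EY N.prob_space[simplified])
  have "(\<integral>z. (W z)\<^sup>2 \<partial>N) = (\<Sum>k\<le>c. (2 * real k + 1) * q k) - L\<^sup>2"
    unfolding W_def using N.variance_eq[OF intY intY2] by (simp add: EY EY2)
  then have EW2: "(\<integral>z. (W z)\<^sup>2 \<partial>N) \<le> (\<Sum>k\<le>c. (2 * real k + 1) * q k)"
    by simp
  define S where "S z = (\<Sum>i<n. W (z i))" for z :: "nat \<Rightarrow> ereal"
  have [measurable]: "S \<in> borel_measurable ?P" unfolding S_def by measurable
  have W_bound: "\<bar>W z\<bar> \<le> c + 1 + L" for z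
    unfolding W_def using Y_bound[of z] \<open>L > 0\<close> by auto
  have ES2: "(\<integral>z. (S z)\<^sup>2 \<partial>?P) \<le> real n * (\<Sum>k\<le>c. (2 * real k + 1) * q k)"
    unfolding S_def
    by (subst sum_second_moment_iid[where K = "c + 1 + L"])
      (use EW EW2 W_bound N.prob_space_axioms in \<open>auto intro!: mult_left_mono\<close>)
  have S_bound: "\<bar>S z\<bar> \<le> real n * (c + 1 + L)" for z
    unfolding S_def using W_bound by (intro order_trans[OF sum_abs]) (auto intro!: sum_bounded_above[THEN order_trans])
  have intS2: "integrable ?P (\<lambda>z. (S z)\<^sup>2)"
    by (rule P.integrable_const_bound[where B = "(real n * (c + 1 + L))\<^sup>2"])
       (use S_bound in \<open>auto simp: abs_le_square_iff[symmetric] intro: order_trans[OF _ abs_ge_self]\<close>)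
  define d where "d = \<epsilon> * (real n * L)"
  have "d > 0" using assms by (simp add: d_def)
  let ?big = "{z \<in> space ?P. d\<^sup>2 \<le> (S z)\<^sup>2}"
  have "P.prob ?big \<le> (\<integral>z. (S z)\<^sup>2 \<partial>?P) / d\<^sup>2"
    using \<open>d > 0\<close> by (intro integral_Markov_inequality_measure[OF intS2, where A = "{}"]) auto
  also have "\<dots> \<le> real n * (\<Sum>k\<le>c. (2 * real k + 1) * q k) / d\<^sup>2"
    using ES2 by (intro divide_right_mono) auto
  also have "\<dots> = (\<Sum>k\<le>c. (2 * real k + 1) * q k) / (real n * L\<^sup>2) / \<epsilon>\<^sup>2"
    using assms by (simp add: d_def power2_eq_square field_simps)
  finally have big: "P.prob ?big \<le> (\<Sum>k\<le>c. (2 * real k + 1) * q k) / (real n * L\<^sup>2) / \<epsilon>\<^sup>2" .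
  let ?jump = "\<Union>i<n. {z \<in> space ?P. ereal (real c) < z i}"
  have "P.prob ?jump \<le> (\<Sum>i<n. P.prob {z \<in> space ?P. ereal (real c) < z i})"
    by (rule P.finite_measure_subadditive_finite) auto
  also have "\<dots> = (\<Sum>i<n. q c)"
  proof (rule sum.cong[OF refl])
    fix i
    have "q c = measure (distr ?P N (\<lambda>z. z i)) {ereal (real c)<..}"
      by (subst P.PiM_component) (auto simp: q_def)
    also have "\<dots> = P.prob {z \<in> space ?P. ereal (real c) < z i}"
      by (subst measure_distr) (auto intro!: arg_cong[where f = P.prob])
    finally show "P.prob {z \<in> space ?P. ereal (real c) < z i} = q c" by simp
  qed
  finally have jump: "P.prob ?jump \<le> real n * q c" by simp
  have AE_P: "AE z in ?P. \<forall>i. z i = \<infinity> \<or> (\<exists>k::nat. z i = ereal (real k))"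
    by (subst AE_all_countable) (auto intro!: P.AE_component AE)
  have "P.prob {z \<in> space ?P. \<bar>(\<Sum>i<n. z i) / ereal (real n * L) - 1\<bar> > ereal \<epsilon>} \<le> P.prob (?jump \<union> ?big)"
  proof (rule P.finite_measure_mono_AE)
    show "AE z in ?P. z \<in> {z \<in> space ?P. \<bar>(\<Sum>i<n. z i) / ereal (real n * L) - 1\<bar> > ereal \<epsilon>} \<longrightarrow> z \<in> ?jump \<union> ?big"
      using AE_P
    proof (eventually_elim, intro impI)
      fix z :: "nat \<Rightarrow> ereal"
      assume nice: "\<forall>i. z i = \<infinity> \<or> (\<exists>k::nat. z i = ereal (real k))"
        and z: "z \<in> {z \<in> space ?P. \<bar>(\<Sum>i<n. z i) / ereal (real n * L) - 1\<bar> > ereal \<epsilon>}"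
      show "z \<in> ?jump \<union> ?big"
      proof (cases "z \<in> ?jump")
        case False
        then have le: "z i \<le> ereal (real c)" if "i < n" for i
          using z that by (auto simp: not_less)
        have zY: "z i = ereal (Y (z i))" if i: "i < n" for i
        proof -
          obtain k :: nat where k: "z i = ereal k"
            using nice le[OF i] by (metis ereal_infty_less_eq(1) PInfty_neq_ereal(1))
          have "k \<le> c" using le[OF i] by (simp add: k)
          have "Y (z i) = (\<Sum>j\<le>c. if j < k then 1 else 0)"
            unfolding Y_def k by (intro sum.cong) (auto simp: indicator_def)
          also have "\<dots> = (\<Sum>j<k. 1)"
            using \<open>k \<le> c\<close> by (intro sum.mono_neutral_cong_right) auto
          finally show ?thesis using k by simp
        qed
        have "\<bar>(\<Sum>i<n. Y (z i)) / (real n * L) - 1\<bar> > \<epsilon>"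
          using z assms by (intro ereal_sum_truncation[OF zY]) auto
        moreover have "(\<Sum>i<n. Y (z i)) / (real n * L) - 1 = S z / (real n * L)"
          using assms by (simp add: S_def W_def sum_subtractf field_simps)
        ultimately have "\<bar>S z\<bar> > d"
          using assms by (simp add: d_def field_simps)
        then have "d\<^sup>2 \<le> (S z)\<^sup>2"
          using \<open>d > 0\<close> by (simp add: abs_le_square_iff[symmetric])
        then show ?thesis using z by simp
      qed simp
    qed
  qed measurable
  also have "\<dots> \<le> P.prob ?jump + P.prob ?big"
    by (rule measure_Un_le) measurable
  finally show ?thesis using jump big by simp
qed

section \<open>Choice of the truncation levels\<close>

text \<open>Beyond some K, a k <= (r/2) b k <= (r/2) b n by monotonicity of b; the fixed head of the
  sum is absorbed because (n + 1) b n is at least (n + 1) b 0.\<close>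

lemma cesaro_weighted:
  fixes a b :: "nat \<Rightarrow> real"
  assumes "incseq b" "0 < b 0" "\<And>k. 0 \<le> a k" "(\<lambda>k. a k / b k) \<longlonglongrightarrow> 0"
  shows "(\<lambda>c. (\<Sum>k\<le>c. a k) / ((real c + 1) * b c)) \<longlonglongrightarrow> 0"
proof (rule LIMSEQ_I)
  fix r :: real assume "0 < r"
  have b: "0 < b k" "b 0 \<le> b k" for k
    using assms(2) incseqD[OF assms(1), of 0 k] by auto
  obtain K where K: "\<And>k. k \<ge> K \<Longrightarrow> norm (a k / b k - 0) < r / 2"
    using LIMSEQ_D[OF assms(4), of "r / 2"] \<open>0 < r\<close> by auto
  have aK: "a k \<le> r / 2 * b k" if "k \<ge> K" for k
    using K[OF that] b[of k] assms(3)[of k] by (simp add: field_simps)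
  define s where "s = (\<Sum>k<K. a k)"
  have s: "0 \<le> s" unfolding s_def by (intro sum_nonneg assms)
  obtain M :: nat where M: "2 * s / (r * b 0) < M" using reals_Archimedean2 by blast
  show "\<exists>no. \<forall>n\<ge>no. norm ((\<Sum>k\<le>n. a k) / ((real n + 1) * b n) - 0) < r"
  proof (intro exI allI impI)
    fix n assume n: "M \<le> n"
    have "(\<Sum>k\<le>n. a k) \<le> (\<Sum>k\<le>n. (if k < K then a k else 0) + r / 2 * b n)"
    proof (rule sum_mono)
      fix k assume "k \<in> {..n}"
      then have "b k \<le> b n" using incseqD[OF assms(1)] by simp
      then have "r / 2 * b k \<le> r / 2 * b n" "0 \<le> r / 2 * b n"
        using \<open>0 < r\<close> b[of n] by (auto intro!: mult_left_mono)
      then show "a k \<le> (if k < K then a k else 0) + r / 2 * b n"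
        using aK[of k] by auto
    qed
    also have "\<dots> = (\<Sum>k\<in>{..n} \<inter> {..<K}. a k) + (real n + 1) * (r / 2 * b n)"
      by (simp add: sum.distrib sum.If_cases lessThan_def algebra_simps)
    also have "(\<Sum>k\<in>{..n} \<inter> {..<K}. a k) \<le> s"
      unfolding s_def using assms(3) by (intro sum_mono2) auto
    finally have 1: "(\<Sum>k\<le>n. a k) \<le> s + (real n + 1) * (r / 2 * b n)" by simp
    have "2 * s / (r * b 0) < real n + 1" using M n by linarith
    then have "s < r / 2 * ((real n + 1) * b 0)"
      using \<open>0 < r\<close> b[of 0] by (simp add: field_simps)
    also have "\<dots> \<le> r / 2 * ((real n + 1) * b n)"
      using \<open>0 < r\<close> b[of n] by (intro mult_left_mono) auto
    finally have "s < r / 2 * ((real n + 1) * b n)" .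
    moreover have "(real n + 1) * (r / 2 * b n) = r / 2 * ((real n + 1) * b n)"
      by simp
    ultimately have "(\<Sum>k\<le>n. a k) < r * ((real n + 1) * b n)"
      using 1 by linarith
    moreover have "0 < (real n + 1) * b n" using b[of n] by simp
    moreover have "0 \<le> (\<Sum>k\<le>n. a k)" by (intro sum_nonneg assms)
    ultimately show "norm ((\<Sum>k\<le>n. a k) / ((real n + 1) * b n) - 0) < r"
      by (simp add: pos_divide_less_eq)
  qed
qed

text \<open>The level \<open>c n\<close> is the least c with n L(c) <= c + 1, so for n > 0 the two
  sides agree up to a factor 2. One direction of this balance controls n q(c n), the other the
  variance term.\<close>

lemma truncation_levels:
  fixes q :: "nat \<Rightarrow> real"
  defines "L \<equiv> \<lambda>c. \<Sum>k\<le>c. q k"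
  assumes q0: "q 0 = 1" and q: "\<And>k. 0 \<le> q k" "\<And>k. q k \<le> 1"
    and lim: "(\<lambda>j. (real j + 1) * q j / L j) \<longlonglongrightarrow> 0"
  obtains c :: "nat \<Rightarrow> nat" where "(\<lambda>n. real n * q (c n)) \<longlonglongrightarrow> 0"
    "(\<lambda>n. (\<Sum>k\<le>c n. (2 * real k + 1) * q k) / (real n * (L (c n))\<^sup>2)) \<longlonglongrightarrow> 0"
proof -
  have L_mono: "incseq L"
    unfolding L_def by (intro incseq_SucI) (simp add: q)
  have L0: "L 0 = 1" by (simp add: L_def q0)
  have L1: "1 \<le> L j" for j using incseqD[OF L_mono, of 0 j] L0 by simp
  have Lj: "L j \<le> real j + 1" for j
    unfolding L_def using sum_bounded_above[of "{..j}" q 1] q by simp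
  \<comment> \<open>From L j <= j + 1. This excludes mass at infinity and gives L c = o(c), hence
    the existence of the levels.\<close>
  have "q \<longlonglongrightarrow> 0"
  proof (rule tendsto_sandwich[OF _ _ tendsto_const lim])
    have "q j \<le> (real j + 1) * q j / L j" for j
      using mult_right_mono[OF Lj[of j] q(1)[of j]] L1[of j] by (simp add: field_simps)
    then show "\<forall>\<^sub>F j in sequentially. q j \<le> (real j + 1) * q j / L j" by simp
  qed (simp add: q)
  then have Lo: "(\<lambda>c. L c / (real c + 1)) \<longlonglongrightarrow> 0"
    using cesaro_weighted[of "\<lambda>_. 1" q] by (simp add: q L_def incseq_def)
  have Vo: "(\<lambda>c. (\<Sum>k\<le>c. (2 * real k + 1) * q k) / ((real c + 1) * L c)) \<longlonglongrightarrow> 0"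
  proof (rule cesaro_weighted[OF L_mono])
    show "(\<lambda>k. (2 * real k + 1) * q k / L k) \<longlonglongrightarrow> 0"
    proof (rule tendsto_sandwich[OF _ _ tendsto_const tendsto_mult_right_zero[OF lim, of 2]])
      have "(2 * real k + 1) * q k \<le> 2 * ((real k + 1) * q k)" for k
        using q[of k] by (simp add: algebra_simps)
      then have "(2 * real k + 1) * q k / L k \<le> 2 * ((real k + 1) * q k / L k)" for k
        using L1[of k] by (simp add: field_simps)
      then show "\<forall>\<^sub>F k in sequentially. (2 * real k + 1) * q k / L k \<le> 2 * ((real k + 1) * q k / L k)"
        by simp
      have "0 \<le> (2 * real k + 1) * q k / L k" for k
        using q(1)[of k] L1[of k] by (intro divide_nonneg_nonneg mult_nonneg_nonneg) auto
      then show "\<forall>\<^sub>F k in sequentially. 0 \<le> (2 * real k + 1) * q k / L k" by simp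
    qed
  qed (auto simp: L0 q)
  have ex: "\<exists>c. real n * L c \<le> real c + 1" for n :: nat
  proof -
    have "\<forall>\<^sub>F c in sequentially. L c / (real c + 1) < 1 / (real n + 1)"
      by (rule order_tendstoD(2)[OF Lo]) simp
    then obtain c where "L c / (real c + 1) < 1 / (real n + 1)"
      by (meson eventually_happens' sequentially_bot)
    then have "(real n + 1) * L c < real c + 1" by (simp add: field_simps)
    moreover have "real n * L c \<le> (real n + 1) * L c" using L1[of c] by (simp add: algebra_simps)
    ultimately show ?thesis by (intro exI[of _ c]) simp
  qed
  define c where "c n = (LEAST c. real n * L c \<le> real c + 1)" for n :: nat
  have c1: "real n * L (c n) \<le> real (c n) + 1" for n
    unfolding c_def by (rule LeastI_ex[OF ex])
  \<comment> \<open>By minimality the defining inequality fails at c n - 1; for c n = 0 the claim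
    comes from L 0 = 1.\<close>
  have c2: "real (c n) + 1 \<le> 2 * (real n * L (c n))" if "n > 0" for n
  proof (cases "c n")
    case 0
    then show ?thesis using that L0 by simp
  next
    case (Suc c')
    then have "\<not> real n * L c' \<le> real c' + 1"
      unfolding c_def using not_less_Least[of c' "\<lambda>c. real n * L c \<le> real c + 1"] by simp
    then have "real (c n) \<le> real n * L c'" using Suc by simp
    also have "\<dots> \<le> real n * L (c n)"
      using incseqD[OF L_mono, of c' "c n"] Suc by (intro mult_left_mono) auto
    finally have "real (c n) \<le> real n * L (c n)" .
    moreover have "1 * 1 \<le> real n * L (c n)" using that L1 by (intro mult_mono) auto
    ultimately show ?thesis by simp
  qed
  \<comment> \<open>L >= 1 drives \<open>c n\<close> to infinity, so limits in the level can be
    taken along it.\<close>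
  have c_ge: "n \<le> c n + 1" for n
  proof -
    have "real n * 1 \<le> real n * L (c n)" using L1 by (intro mult_left_mono) auto
    then have "real n \<le> real (c n + 1)" using c1[of n] by simp
    then show ?thesis by simp
  qed
  have c_lim: "filterlim c at_top sequentially"
    unfolding filterlim_at_top
  proof
    fix Z
    show "\<forall>\<^sub>F n in sequentially. Z \<le> c n"
      using eventually_ge_at_top[of "Z + 1"] by eventually_elim (use c_ge in \<open>meson add_le_cancel_right order_trans\<close>)
  qed
  show ?thesis
  proof
    show "(\<lambda>n. real n * q (c n)) \<longlonglongrightarrow> 0"
    proof (rule tendsto_sandwich[OF _ _ tendsto_const filterlim_compose[OF lim c_lim]])
      have "real n * q (c n) \<le> (real (c n) + 1) * q (c n) / L (c n)" for n
        using mult_right_mono[OF c1[of n] q(1)[of "c n"]] L1[of "c n"] by (simp add: field_simps)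
      then show "\<forall>\<^sub>F n in sequentially. real n * q (c n) \<le> (real (c n) + 1) * q (c n) / L (c n)" by simp
    qed (simp add: q)
    let ?V = "\<lambda>c. (\<Sum>k\<le>c. (2 * real k + 1) * q k)"
    have V: "0 \<le> ?V c" for c by (intro sum_nonneg mult_nonneg_nonneg) (auto simp: q)
    show "(\<lambda>n. ?V (c n) / (real n * (L (c n))\<^sup>2)) \<longlonglongrightarrow> 0"
    proof (rule tendsto_sandwich[OF _ _ tendsto_const
          tendsto_mult_right_zero[OF filterlim_compose[OF Vo c_lim], of 2]])
      show "\<forall>\<^sub>F n in sequentially. 0 \<le> ?V (c n) / (real n * (L (c n))\<^sup>2)"
        using V by (intro always_eventually allI divide_nonneg_nonneg) auto
      show "\<forall>\<^sub>F n in sequentially. ?V (c n) / (real n * (L (c n))\<^sup>2) \<le> 2 * (?V (c n) / ((real (c n) + 1) * L (c n)))"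
        using eventually_gt_at_top[of 0]
      proof eventually_elim
        fix n :: nat assume n: "0 < n"
        have "(real (c n) + 1) * L (c n) \<le> 2 * (real n * L (c n)) * L (c n)"
          using c2[OF n] L1[of "c n"] by (intro mult_right_mono) auto
        then have "?V (c n) / (2 * (real n * L (c n)) * L (c n)) \<le> ?V (c n) / ((real (c n) + 1) * L (c n))"
          using V[of "c n"] L1[of "c n"] n
          by (intro divide_left_mono) (auto intro!: mult_pos_pos)
        then show "?V (c n) / (real n * (L (c n))\<^sup>2) \<le> 2 * (?V (c n) / ((real (c n) + 1) * L (c n)))"
          by (simp only: power2_eq_square mult.assoc flip: divide_divide_eq_left') simp
      qed
    qed
  qed
qed

text \<open>The normalisation is B n = n L(c n), the mean of the sum of n truncated copies. The tail
  \<open>q\<close> includes the mass at infinity.\<close>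

lemma relatively_stable_if_tail:
  fixes M :: "'a measure" and Z :: "'a \<Rightarrow> ereal"
  defines "q \<equiv> \<lambda>j::nat. measure M {\<omega> \<in> space M. ereal j < Z \<omega>}"
  assumes "prob_space M" and Z [measurable]: "Z \<in> borel_measurable M"
    and AE: "AE \<omega> in M. Z \<omega> = \<infinity> \<or> (\<exists>k::nat. Z \<omega> = ereal (real k))"
    and q0: "q 0 = 1"
    and lim: "(\<lambda>j. (real j + 1) * q j / (\<Sum>k\<le>j. q k)) \<longlonglongrightarrow> 0"
  shows "relatively_stable M Z"
proof -
  interpret prob_space M by fact
  define N where "N = distr M borel Z"
  have N: "prob_space N" "sets N = sets borel"
    unfolding N_def by (auto intro: prob_space_distr)
  have AE_N: "AE z in N. z = \<infinity> \<or> (\<exists>k::nat. z = ereal (real k))"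
    unfolding N_def by (subst AE_distr_iff) (use AE in \<open>auto simp: borel_measurable_ereal\<close>)
  have qN: "measure N {ereal (real j)<..} = q j" for j
    unfolding N_def q_def
    by (subst measure_distr) (auto intro!: arg_cong[where f = "measure M"])
  obtain c where c: "(\<lambda>n. real n * q (c n)) \<longlonglongrightarrow> 0"
    "(\<lambda>n. (\<Sum>k\<le>c n. (2 * real k + 1) * q k) / (real n * (\<Sum>k\<le>c n. q k)\<^sup>2)) \<longlonglongrightarrow> 0"
    using truncation_levels[OF q0 _ _ lim] by (auto simp: q_def)
  define L where "L n = (\<Sum>k\<le>c n. q k)" for n
  have L: "0 < L n" for n
    unfolding L_def using member_le_sum[of 0 "{..c n}" q] q0 by (auto simp: q_def)
  let ?P = "\<Pi>\<^sub>M i\<in>(UNIV::nat set). N"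
  have "(\<lambda>n. measure ?P {z \<in> space ?P. \<bar>(\<Sum>i<n. z i) / ereal (real n * L n) - 1\<bar> > ereal \<epsilon>}) \<longlonglongrightarrow> 0"
    if "\<epsilon> > 0" for \<epsilon>
  proof (rule tendsto_sandwich[OF _ _ tendsto_const])
    show "(\<lambda>n. real n * q (c n) + (\<Sum>k\<le>c n. (2 * real k + 1) * q k) / (real n * (L n)\<^sup>2) / \<epsilon>\<^sup>2) \<longlonglongrightarrow> 0"
      using tendsto_add[OF c(1) tendsto_divide_zero[OF c(2), of "\<epsilon>\<^sup>2"]] by (simp add: L_def)
    show "\<forall>\<^sub>F n in sequentially. measure ?P {z \<in> space ?P. \<bar>(\<Sum>i<n. z i) / ereal (real n * L n) - 1\<bar> > ereal \<epsilon>}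
      \<le> real n * q (c n) + (\<Sum>k\<le>c n. (2 * real k + 1) * q k) / (real n * (L n)\<^sup>2) / \<epsilon>\<^sup>2"
      using eventually_gt_at_top[of 0]
    proof eventually_elim
      case (elim n)
      show ?case
        using weak_law_truncated[OF N AE_N elim, of "c n" \<epsilon>] L[of n] that by (simp add: qN L_def)
    qed
  qed auto
  then show ?thesis
    unfolding relatively_stable_def Let_def N_def[symmetric] by (intro exI[of _ "\<lambda>n. real n * L n"]) auto
qed

section \<open>The truncated moment generating function\<close>

text \<open>Both sides are \<open>enn2real\<close> of one nonnegative iterated integral. If that is
  infinite, both Bochner integrals take the default value 0, so the identity covers this case as
  well.\<close>

lemma integral_tonelli:
  fixes h :: "real \<Rightarrow> 'a \<Rightarrow> real"
  assumes "prob_space M" and S [measurable]: "S \<in> sets borel"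
    and h [measurable]: "(\<lambda>(s, \<omega>). h s \<omega>) \<in> borel_measurable (lborel \<Otimes>\<^sub>M M)"
    and pos: "\<And>s \<omega>. 0 \<le> h s \<omega>"
    and int: "\<And>s. s \<in> S \<Longrightarrow> integrable M (h s)"
    and g: "\<And>\<omega>. \<omega> \<in> space M \<Longrightarrow> 0 \<le> g \<omega>"
      "\<And>\<omega>. \<omega> \<in> space M \<Longrightarrow> (\<integral>\<^sup>+s. ennreal (h s \<omega>) * indicator S s \<partial>lborel) = ennreal (g \<omega>)"
  shows "(LBINT s:S. \<integral>\<omega>. h s \<omega> \<partial>M) = (\<integral>\<omega>. g \<omega> \<partial>M)"
proof -
  interpret prob_space M by fact
  interpret pair_sigma_finite lborel M ..
  have gm: "g \<in> borel_measurable M"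
  proof -
    have "(\<lambda>\<omega>. enn2real (\<integral>\<^sup>+s. ennreal (h s \<omega>) * indicator S s \<partial>lborel)) \<in> borel_measurable M"
      by measurable
    moreover have "enn2real (\<integral>\<^sup>+s. ennreal (h s \<omega>) * indicator S s \<partial>lborel) = g \<omega>"
      if "\<omega> \<in> space M" for \<omega>
      using g that by simp
    ultimately show ?thesis by (simp cong: measurable_cong)
  qed
  have "(LBINT s:S. \<integral>\<omega>. h s \<omega> \<partial>M) =
      enn2real (\<integral>\<^sup>+s. ennreal (indicator S s * (\<integral>\<omega>. h s \<omega> \<partial>M)) \<partial>lborel)"
    unfolding set_lebesgue_integral_def using pos
    by (subst integral_eq_nn_integral) (auto intro!: integral_nonneg)
  also have "(\<integral>\<^sup>+s. ennreal (indicator S s * (\<integral>\<omega>. h s \<omega> \<partial>M)) \<partial>lborel) =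
      (\<integral>\<^sup>+s. (\<integral>\<^sup>+\<omega>. ennreal (h s \<omega>) * indicator S s \<partial>M) \<partial>lborel)"
  proof (rule nn_integral_cong)
    fix s
    show "ennreal (indicator S s * (\<integral>\<omega>. h s \<omega> \<partial>M)) = (\<integral>\<^sup>+\<omega>. ennreal (h s \<omega>) * indicator S s \<partial>M)"
      using nn_integral_eq_integral[OF int, of s] pos by (auto simp: indicator_def)
  qed
  also have "\<dots> = (\<integral>\<^sup>+\<omega>. (\<integral>\<^sup>+s. ennreal (h s \<omega>) * indicator S s \<partial>lborel) \<partial>M)"
    by (rule Fubini'[symmetric]) measurable
  also have "\<dots> = (\<integral>\<^sup>+\<omega>. ennreal (g \<omega>) \<partial>M)"
    by (rule nn_integral_cong) (simp add: g)
  also have "enn2real \<dots> = (\<integral>\<omega>. g \<omega> \<partial>M)"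
    using g gm by (subst integral_eq_nn_integral) auto
  finally show ?thesis .
qed

text \<open>Tonelli applied to the indicator of y < V. The set {0..x} yields the truncations behind
  \<open>A_fun\<close>, the set {x..} the positive parts behind \<open>eta_plus\<close> and
  \<open>eta_minus\<close>.\<close>

lemma layer_cake:
  fixes V :: "'a \<Rightarrow> real"
  assumes "prob_space M" and S [measurable]: "S \<in> sets borel"
    and V [measurable]: "V \<in> borel_measurable M"
    and g: "\<And>v. 0 \<le> g v" "\<And>v. emeasure lborel (S \<inter> {..<v}) = ennreal (g v)"
  shows "(LBINT y:S. measure M {\<omega> \<in> space M. y < V \<omega>}) = (\<integral>\<omega>. g (V \<omega>) \<partial>M)"
proof -
  interpret prob_space M by fact
  have "(LBINT y:S. measure M {\<omega> \<in> space M. y < V \<omega>}) =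
      (LBINT y:S. \<integral>\<omega>. indicator {..<V \<omega>} y \<partial>M)"
  proof (intro set_lebesgue_integral_cong ballI allI impI)
    fix y
    have "(\<integral>\<omega>. indicator {..<V \<omega>} y \<partial>M) = (\<integral>\<omega>. indicator {\<omega> \<in> space M. y < V \<omega>} \<omega> \<partial>M :: real)"
      by (intro Bochner_Integration.integral_cong) (auto simp: indicator_def)
    then show "measure M {\<omega> \<in> space M. y < V \<omega>} = (\<integral>\<omega>. indicator {..<V \<omega>} y \<partial>M)"
      by simp
  qed simp
  also have "\<dots> = (\<integral>\<omega>. g (V \<omega>) \<partial>M)"
  proof (rule integral_tonelli[OF assms(1) S])
    have "(\<lambda>(s, \<omega>). indicator {..<V \<omega>} s :: real) = (\<lambda>(s, \<omega>). if s < V \<omega> then 1 else 0)"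
      by (auto simp: fun_eq_iff indicator_def)
    then show "(\<lambda>(s, \<omega>). indicator {..<V \<omega>} s :: real) \<in> borel_measurable (lborel \<Otimes>\<^sub>M M)"
      by simp
    show "integrable M (\<lambda>\<omega>. indicator {..<V \<omega>} s :: real)" for s
    proof (rule integrable_const_bound[where B = 1])
      have "(\<lambda>\<omega>. indicator {..<V \<omega>} s :: real) = (\<lambda>\<omega>. if s < V \<omega> then 1 else 0)"
        by (auto simp: fun_eq_iff indicator_def)
      then show "(\<lambda>\<omega>. indicator {..<V \<omega>} s :: real) \<in> borel_measurable M" by simp
    qed (simp add: indicator_def)
    have "(\<integral>\<^sup>+s. ennreal (indicator {..<v} s) * indicator S s \<partial>lborel) = ennreal (g v)" for v
    proof -
      have "(\<integral>\<^sup>+s. ennreal (indicator {..<v} s) * indicator S s \<partial>lborel) =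
          (\<integral>\<^sup>+s. indicator (S \<inter> {..<v}) s \<partial>lborel)"
        by (intro nn_integral_cong) (auto simp: indicator_def)
      then show ?thesis by (simp add: g)
    qed
    then show "(\<integral>\<^sup>+s. ennreal (indicator {..<V \<omega>} s) * indicator S s \<partial>lborel) = ennreal (g (V \<omega>))" for \<omega>
      by simp
  qed (auto simp: g)
  finally show ?thesis .
qed

lemma emeasure_Icc_lessThan:
  fixes a b v :: real
  assumes "a \<le> b"
  shows "emeasure lborel ({a..b} \<inter> {..<v}) = ennreal (min (b - a) (max 0 (v - a)))"
proof -
  consider "v \<le> a" | "a < v" "v \<le> b" | "b < v" by linarith
  then show ?thesis
  proof cases
    case 1
    then have "{a..b} \<inter> {..<v} = {}" by auto
    with 1 assms show ?thesis by simp
  next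
    case 2
    then have "{a..b} \<inter> {..<v} = {a..<v}" by auto
    with 2 show ?thesis by simp
  next
    case 3
    then have "{a..b} \<inter> {..<v} = {a..b}" by auto
    with 3 assms show ?thesis by simp
  qed
qed

lemma emeasure_atLeast_lessThan:
  fixes a v :: real
  shows "emeasure lborel ({a..} \<inter> {..<v}) = ennreal (max 0 (v - a))"
proof -
  have "{a..} \<inter> {..<v} = {a..<v}" by auto
  then show ?thesis by (simp add: max_def ennreal_neg)
qed

text \<open>The Huber function: for u >= 0 and x > 0 it is the integral of max 0 (u - s) over s in
  [0, x], so its expectation at |Y| is m(x) for integrable Y.\<close>

definition trunc_sq :: "real \<Rightarrow> real \<Rightarrow> real" where
  "trunc_sq x u = (if u \<le> x then u\<^sup>2 / 2 else x * u - x\<^sup>2 / 2)"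

lemma measurable_trunc_sq [measurable]: "trunc_sq x \<in> borel_measurable borel"
  unfolding trunc_sq_def by measurable

lemma trunc_sq_bounds:
  assumes "0 < x" "0 \<le> u"
  shows "0 \<le> trunc_sq x u" "trunc_sq x u \<le> x * u"
proof -
  have "x * x \<le> x * u" if "x < u" using that assms by (intro mult_left_mono) auto
  then show "0 \<le> trunc_sq x u" using assms by (auto simp: trunc_sq_def power2_eq_square)
  have "0 \<le> x * u" using assms by simp
  moreover have "u * u \<le> x * u" if "u \<le> x" using that assms by (intro mult_right_mono) auto
  moreover have "0 \<le> x * x" by simp
  ultimately show "trunc_sq x u \<le> x * u" by (auto simp: trunc_sq_def power2_eq_square)
qed

lemma trunc_sq_mono:
  assumes "0 < x" "x \<le> y" "0 \<le> u"
  shows "trunc_sq x u \<le> trunc_sq y u"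
proof -
  have 1: "x * u - x\<^sup>2 / 2 \<le> u\<^sup>2 / 2"
    using sum_squares_ge_zero[of "u - x" 0] by (simp add: power2_eq_square algebra_simps)
  \<comment> \<open>This product is twice the difference of the two affine branches.\<close>
  have "0 \<le> (y - x) * (u - x + (u - y))" if "y < u" using that assms by simp
  then have 2: "x * u - x\<^sup>2 / 2 \<le> y * u - y\<^sup>2 / 2" if "y < u"
    using that by (simp add: power2_eq_square algebra_simps)
  show ?thesis using 1 2 assms by (auto simp: trunc_sq_def)
qed

lemma nn_integral_positive_part_Icc:
  fixes u x :: real
  assumes "0 \<le> u" "0 < x"
  shows "(\<integral>\<^sup>+s. ennreal (max 0 (u - s)) * indicator {0..x} s \<partial>lborel) =
    ennreal (trunc_sq x u)"
proof -
  have ftc: "(\<integral>\<^sup>+s. ennreal (u - s) * indicator {0..b} s \<partial>lborel) = ennreal (b * u - b\<^sup>2 / 2)"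
    if "0 \<le> b" "b \<le> u" for b
  proof -
    have "(\<integral>\<^sup>+s. ennreal (u - s) * indicator {0..b} s \<partial>lborel) =
        ennreal ((b * u - b\<^sup>2 / 2) - (0 * u - 0\<^sup>2 / 2))"
      by (rule nn_integral_FTC_Icc[where F = "\<lambda>s. s * u - s\<^sup>2 / 2"])
         (use that in \<open>auto intro!: derivative_eq_intros\<close>)
    then show ?thesis by simp
  qed
  show ?thesis
  proof (cases "u \<le> x")
    case True
    have "(\<integral>\<^sup>+s. ennreal (max 0 (u - s)) * indicator {0..x} s \<partial>lborel) =
        (\<integral>\<^sup>+s. ennreal (u - s) * indicator {0..u} s \<partial>lborel)"
      using True by (intro nn_integral_cong) (auto simp: indicator_def max_def)
    then show ?thesis using ftc[of u] assms True by (simp add: trunc_sq_def power2_eq_square field_simps)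
  next
    case False
    have "(\<integral>\<^sup>+s. ennreal (max 0 (u - s)) * indicator {0..x} s \<partial>lborel) =
        (\<integral>\<^sup>+s. ennreal (u - s) * indicator {0..x} s \<partial>lborel)"
      using False by (intro nn_integral_cong) (auto simp: indicator_def max_def)
    then show ?thesis using ftc[of x] assms False by (simp add: trunc_sq_def)
  qed
qed

section \<open>Pointwise lower bounds for the truncated exponential\<close>

text \<open>The second bound is the integrated first one: exp(-t) - 1 + t - t^2/4 has derivative 1 -
  t/2 - exp(-t).\<close>

lemma exp_minus_quadratic_lower:
  fixes v :: real
  assumes "0 \<le> v" "v \<le> 1"
  shows "exp (- v) \<le> 1 - v / 2" "1 - v + v\<^sup>2 / 4 \<le> exp (- v)"
proof -
  have half: "exp (- t) \<le> 1 - t / 2" if "0 \<le> t" "t \<le> 1" for t :: real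
  proof -
    \<comment> \<open>The product below equals 1 + t/2 - t^3/4.\<close>
    have "t ^ 3 \<le> 2 * t"
      using that power_decreasing[of 1 3 t] by simp
    then have "1 \<le> (1 + t + t\<^sup>2 / 2) * (1 - t / 2)"
      by (simp add: power2_eq_square power3_eq_cube field_simps)
    also have "\<dots> \<le> exp t * (1 - t / 2)"
      using that exp_lower_Taylor_quadratic[of t] by (intro mult_right_mono) auto
    finally show ?thesis by (simp add: exp_minus field_simps)
  qed
  then show "exp (- v) \<le> 1 - v / 2" using assms by simp
  have "exp (- 0) - 1 + 0 - 0\<^sup>2 / 4 \<le> exp (- v) - 1 + v - v\<^sup>2 / 4"
  proof (rule DERIV_nonneg_imp_nondecreasing[OF assms(1)])
    fix t assume t: "0 \<le> t" "t \<le> v"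
    have "((\<lambda>t. exp (- t) - 1 + t - t\<^sup>2 / 4) has_real_derivative (1 - t / 2 - exp (- t))) (at t)"
      by (auto intro!: derivative_eq_intros simp: power2_eq_square)
    then show "\<exists>y. ((\<lambda>t. exp (- t) - 1 + t - t\<^sup>2 / 4) has_real_derivative y) (at t) \<and> 0 \<le> y"
      using half[of t] t assms by auto
  qed
  then show "1 - v + v\<^sup>2 / 4 \<le> exp (- v)" by simp
qed

text \<open>On [-1, 1] the truncation is the identity and 1 + s <= exp s applies. Outside, the
  subtracted 1 + \<delta> makes the left side nonpositive.\<close>

lemma truncated_exp_lower_linear:
  fixes t \<delta> :: real
  assumes "0 \<le> \<delta>"
  shows "1 + \<delta> * max (- 1) (min 1 t) - (1 + \<delta>) * (if \<bar>t\<bar> > 1 then 1 else 0)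
    \<le> (if t \<le> 1 then exp (\<delta> * t) else 0)"
proof (cases "\<bar>t\<bar> > 1")
  case True
  have "\<delta> * max (- 1) (min 1 t) \<le> \<delta> * 1" using assms by (intro mult_left_mono) auto
  with True show ?thesis by (auto simp: less_imp_le intro: order_trans[OF _ exp_ge_zero])
next
  case False
  then have "max (- 1) (min 1 t) = t" by auto
  with False show ?thesis using exp_ge_add_one_self[of "\<delta> * t"] by auto
qed

text \<open>The bracket is \<open>trunc_sq 1\<close> at |t|; a full square would fail for very
  negative t. The right side drops to 0 just beyond t = 1, where max 0 (t - 1) would still be
  negligible; the penalty therefore starts at 1/2, with a factor large enough for t > 1.\<close>

lemma truncated_exp_lower_quadratic:
  fixes t \<delta> :: real
  assumes "0 < \<delta>" "\<delta> \<le> 1"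
  shows "1 + \<delta> * t + \<delta>\<^sup>2 / 2 * (if \<bar>t\<bar> \<le> 1 then t\<^sup>2 / 2 else \<bar>t\<bar> - 1 / 2) - 6 * max 0 (t - 1 / 2)
    \<le> (if t \<le> 1 then exp (\<delta> * t) else 0)"
proof -
  consider "t > 1" | "0 \<le> t" "t \<le> 1" | "- 1 \<le> t" "t < 0" | "t < - 1" by linarith
  then show ?thesis
  proof cases
    \<comment> \<open>As \<delta> <= 1, the left side is at most 1 + t + (t - 1/2)/2 - 6 (t - 1/2),
      which decreases in t and equals -3/4 at t = 1.\<close>
    case 1
    have "\<delta> * t \<le> 1 * t" using 1 assms by (intro mult_right_mono) auto
    moreover have "\<delta>\<^sup>2 * (t - 1 / 2) \<le> 1 * (t - 1 / 2)"
      using 1 assms by (intro mult_right_mono) (auto simp: power_le_one)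
    moreover have "\<delta>\<^sup>2 / 2 * (t - 1 / 2) = \<delta>\<^sup>2 * (t - 1 / 2) / 2" by simp
    moreover have "max 0 (t - 1 / 2) = t - 1 / 2" "\<bar>t\<bar> = t"
      using 1 by auto
    moreover have "1 + a + c / 2 - 6 * (t - 1 / 2) \<le> 0"
      if "a \<le> 1 * t" "c \<le> 1 * (t - 1 / 2)" for a c :: real
      using that 1 by (simp add: field_simps)
    ultimately have "1 + \<delta> * t + \<delta>\<^sup>2 / 2 * (t - 1 / 2) - 6 * (t - 1 / 2) \<le> 0"
      by metis
    then show ?thesis using 1 by simp
  next
    case 2
    have "1 + \<delta> * t + (\<delta> * t)\<^sup>2 / 2 \<le> exp (\<delta> * t)"
      using 2 assms by (intro exp_lower_Taylor_quadratic) auto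
    moreover have "\<delta>\<^sup>2 / 2 * (t\<^sup>2 / 2) \<le> (\<delta> * t)\<^sup>2 / 2"
      by (simp add: power_mult_distrib)
    moreover have "0 \<le> 6 * max 0 (t - 1 / 2)" by simp
    moreover have "\<bar>t\<bar> \<le> 1" using 2 by simp
    ultimately show ?thesis using 2 by (simp only: if_True)
  next
    case 3
    define v where "v = - (\<delta> * t)"
    have "0 \<le> v" unfolding v_def using 3 assms by (simp add: mult_nonneg_nonpos)
    moreover have "\<delta> * (- t) \<le> 1 * 1" using 3 assms by (intro mult_mono) auto
    ultimately have "1 - v + v\<^sup>2 / 4 \<le> exp (- v)"
      by (intro exp_minus_quadratic_lower) (auto simp: v_def)
    moreover have "\<delta>\<^sup>2 / 2 * (t\<^sup>2 / 2) = v\<^sup>2 / 4"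
      by (simp add: v_def power_mult_distrib)
    ultimately show ?thesis using 3 by (simp add: v_def max_def)
  next
    \<comment> \<open>The tangent of exp(-v) at v = \<delta>, the point where the Huber function
      turns linear, bounds exp(-v) from below. Its slope and value are estimated by the two parts of
      \<open>exp_minus_quadratic_lower\<close>.\<close>
    case 4
    define v where "v = - (\<delta> * t)"
    have "\<delta> * 1 \<le> \<delta> * (- t)" using 4 assms by (intro mult_left_mono) auto
    then have v: "\<delta> \<le> v" by (simp add: v_def)
    have "exp (- \<delta>) * (1 + (\<delta> - v)) \<le> exp (- \<delta>) * exp (\<delta> - v)"
      by (intro mult_left_mono exp_ge_add_one_self) auto
    then have "exp (- \<delta>) - exp (- \<delta>) * (v - \<delta>) \<le> exp (- v)"
      by (simp add: algebra_simps flip: exp_add)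
    moreover have "exp (- \<delta>) * (v - \<delta>) \<le> (1 - \<delta> / 2) * (v - \<delta>)"
      using v assms exp_minus_quadratic_lower[of \<delta>] by (intro mult_right_mono) auto
    moreover have "1 - \<delta> + \<delta>\<^sup>2 / 4 \<le> exp (- \<delta>)"
      using assms exp_minus_quadratic_lower[of \<delta>] by auto
    ultimately have "1 - \<delta> + \<delta>\<^sup>2 / 4 - (1 - \<delta> / 2) * (v - \<delta>) \<le> exp (- v)" by linarith
    moreover have "1 - \<delta> + \<delta>\<^sup>2 / 4 - (1 - \<delta> / 2) * (v - \<delta>) = 1 + \<delta> * t + \<delta>\<^sup>2 / 2 * (\<bar>t\<bar> - 1 / 2)"
      using 4 by (simp add: v_def power2_eq_square field_simps)
    ultimately show ?thesis using 4 by (simp add: v_def max_def)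
  qed
qed

section \<open>(C.I) and (C.II) push the truncated exponential moment above 1\<close>

locale integer_rv = prob_space M for M :: "'a measure" +
  fixes Y :: "'a \<Rightarrow> int"
  assumes Y [measurable]: "Y \<in> measurable M (count_space UNIV)"
begin

text \<open>The positive and negative parts of Y, each cut off at x, come from the two tails; both
  are bounded, so their expectations may be subtracted.\<close>

lemma A_fun_eq:
  assumes "0 < x"
  shows "A_fun M Y x = (\<integral>\<omega>. max (- x) (min x (real_of_int (Y \<omega>))) \<partial>M)"
proof -
  let ?g = "\<lambda>v. min x (max 0 v)"
  have plus: "(LBINT y:{0..x}. mu_plus M Y y) = (\<integral>\<omega>. ?g (real_of_int (Y \<omega>)) \<partial>M)"
    unfolding mu_plus_def using assms
    by (intro layer_cake prob_space_axioms) (auto simp: emeasure_Icc_lessThan)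
  have "mu_minus M Y y = measure M {\<omega> \<in> space M. y < - real_of_int (Y \<omega>)}" for y
    unfolding mu_minus_def by (intro arg_cong[where f = "measure M"]) auto
  then have minus: "(LBINT y:{0..x}. mu_minus M Y y) = (\<integral>\<omega>. ?g (- real_of_int (Y \<omega>)) \<partial>M)"
    using assms layer_cake[of M "{0..x}" "\<lambda>\<omega>. - real_of_int (Y \<omega>)" ?g] prob_space_axioms
    by (simp add: emeasure_Icc_lessThan)
  have "antimono (mu_plus M Y)" "antimono (mu_minus M Y)"
    unfolding mu_plus_def mu_minus_def by (auto intro!: antimonoI finite_measure_mono)
  then have "mono (\<lambda>y. - mu_plus M Y y)" "mono (\<lambda>y. - mu_minus M Y y)"
    by (auto simp: monotone_on_def)
  from this[THEN borel_measurable_mono, THEN borel_measurable_uminus] have [measurable]: "mu_plus M Y \<in> borel_measurable borel" "mu_minus M Y \<in> borel_measurable borel"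
    by simp_all
  have si: "set_integrable lborel {0..x} (mu_plus M Y)" "set_integrable lborel {0..x} (mu_minus M Y)"
    unfolding set_integrable_def
    by (rule integrableI_bounded_set[where A = "{0..x}" and B = 1];
        auto simp: mu_plus_def mu_minus_def indicator_def emeasure_lborel_Icc_eq)+
  have "A_fun M Y x = (LBINT y:{0..x}. mu_plus M Y y) - (LBINT y:{0..x}. mu_minus M Y y)"
    unfolding A_fun_def by (rule set_integral_diff(2)[OF si])
  also have "\<dots> = (\<integral>\<omega>. ?g (real_of_int (Y \<omega>)) - ?g (- real_of_int (Y \<omega>)) \<partial>M)"
    unfolding plus minus using assms
    by (intro Bochner_Integration.integral_diff[symmetric])
      (auto intro!: integrable_const_bound[where B = x])
  also have "\<dots> = (\<integral>\<omega>. max (- x) (min x (real_of_int (Y \<omega>))) \<partial>M)"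
    using assms by (intro Bochner_Integration.integral_cong) auto
  finally show ?thesis .
qed

lemma eta_plus_eq: "eta_plus M Y x = (\<integral>\<omega>. max 0 (real_of_int (Y \<omega>) - x) \<partial>M)"
  unfolding eta_plus_def mu_plus_def
  by (intro layer_cake[OF prob_space_axioms]) (auto simp: emeasure_atLeast_lessThan)

lemma eta_minus_eq: "eta_minus M Y x = (\<integral>\<omega>. max 0 (- real_of_int (Y \<omega>) - x) \<partial>M)"
proof -
  have "mu_minus M Y y = measure M {\<omega> \<in> space M. y < - real_of_int (Y \<omega>)}" for y
    unfolding mu_minus_def by (intro arg_cong[where f = "measure M"]) auto
  then show ?thesis
    using layer_cake[of M "{x..}" "\<lambda>\<omega>. - real_of_int (Y \<omega>)" "\<lambda>v. max 0 (v - x)"] prob_space_axioms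
    by (simp add: eta_minus_def emeasure_atLeast_lessThan)
qed

text \<open>For s >= 0 the positive parts of Y - s and -Y - s add up to that of |Y| - s;
  integrability of Y allows adding the expectations, and Tonelli in s produces
  \<open>trunc_sq\<close>.\<close>

lemma m_fun_eq:
  assumes "0 < x" "integrable M (\<lambda>\<omega>. real_of_int (Y \<omega>))"
  shows "m_fun M Y x = (\<integral>\<omega>. trunc_sq x \<bar>real_of_int (Y \<omega>)\<bar> \<partial>M)"
proof -
  have int: "integrable M (\<lambda>\<omega>. max 0 (\<bar>real_of_int (Y \<omega>)\<bar> - s))"
    "integrable M (\<lambda>\<omega>. max 0 (real_of_int (Y \<omega>) - s))"
    "integrable M (\<lambda>\<omega>. max 0 (- real_of_int (Y \<omega>) - s))" for s
    using assms(2) by auto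
  have "eta M Y s = (\<integral>\<omega>. max 0 (\<bar>real_of_int (Y \<omega>)\<bar> - s) \<partial>M)" if "0 \<le> s" for s
  proof -
    have "eta M Y s = (\<integral>\<omega>. max 0 (real_of_int (Y \<omega>) - s) + max 0 (- real_of_int (Y \<omega>) - s) \<partial>M)"
      unfolding eta_def eta_plus_eq eta_minus_eq using int by simp
    also have "\<dots> = (\<integral>\<omega>. max 0 (\<bar>real_of_int (Y \<omega>)\<bar> - s) \<partial>M)"
      using that by (intro Bochner_Integration.integral_cong) auto
    finally show ?thesis .
  qed
  then have "m_fun M Y x = (LBINT s:{0..x}. \<integral>\<omega>. max 0 (\<bar>real_of_int (Y \<omega>)\<bar> - s) \<partial>M)"
    unfolding m_fun_def by (intro set_lebesgue_integral_cong) auto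
  also have "\<dots> = (\<integral>\<omega>. trunc_sq x \<bar>real_of_int (Y \<omega>)\<bar> \<partial>M)"
    using assms(1) int trunc_sq_bounds
    by (intro integral_tonelli[OF prob_space_axioms])
      (auto simp: nn_integral_positive_part_Icc[OF abs_ge_zero]
        simp del: max.absorb1 max.absorb2 ennreal_max_0)
  finally show ?thesis .
qed

definition trunc_mgf :: "real \<Rightarrow> real \<Rightarrow> real" where
  "trunc_mgf \<theta> x = (\<integral>\<omega>. (if real_of_int (Y \<omega>) \<le> x then exp (\<theta> * real_of_int (Y \<omega>)) else 0) \<partial>M)"

lemma integrable_trunc_mgf:
  assumes "0 \<le> \<theta>"
  shows "integrable M (\<lambda>\<omega>. if real_of_int (Y \<omega>) \<le> x then exp (\<theta> * real_of_int (Y \<omega>)) else 0)"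
  by (rule integrable_const_bound[where B = "exp (\<theta> * x)"]) (use assms in \<open>auto simp: mult_left_mono\<close>)

text \<open>Taking expectations in \<open>truncated_exp_lower_linear\<close> at t = Y / x bounds the
  moment below by 1 + \<delta> A(x) / x - (1 + \<delta>) mu(x). This exceeds 1 once A(x) / (x mu(x))
  > (1 + \<delta>) / \<delta>; \<open>tail\<close> makes mu(x) positive, so the quotient can be
  cleared.\<close>

lemma trunc_mgf_gt_1_CI:
  assumes "cond_CI M Y" "0 < \<delta>"
    and tail: "\<And>x. 0 < x \<Longrightarrow> 0 < measure M {\<omega> \<in> space M. \<bar>real_of_int (Y \<omega>)\<bar> > x}"
  shows "\<forall>\<^sub>F x in at_top. 1 < trunc_mgf (\<delta> / x) x"
proof -
  have "\<forall>\<^sub>F x in at_top. (1 + \<delta>) / \<delta> < A_fun M Y x / (x * mu M Y x)"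
    using assms(1) unfolding cond_CI_def by (simp add: filterlim_at_top_dense)
  then show ?thesis
    using eventually_gt_at_top[of 0]
  proof eventually_elim
    fix x :: real
    assume x: "0 < x" and A: "(1 + \<delta>) / \<delta> < A_fun M Y x / (x * mu M Y x)"
    have mu: "mu M Y x = measure M {\<omega> \<in> space M. \<bar>real_of_int (Y \<omega>)\<bar> > x}"
      unfolding mu_def mu_plus_def mu_minus_def using x
      by (subst finite_measure_Union[symmetric]) (auto intro!: arg_cong[where f = "measure M"])
    have mu_int: "(\<integral>\<omega>. (if \<bar>real_of_int (Y \<omega>)\<bar> > x then 1 else 0) \<partial>M) = mu M Y x"
    proof -
      have "(\<integral>\<omega>. (if \<bar>real_of_int (Y \<omega>)\<bar> > x then 1 else 0) \<partial>M) =
        (\<integral>\<omega>. indicator {\<omega> \<in> space M. \<bar>real_of_int (Y \<omega>)\<bar> > x} \<omega> \<partial>M)"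
        by (intro Bochner_Integration.integral_cong) (auto simp: indicator_def)
      also have "\<dots> = mu M Y x"
        by (simp add: mu)
      finally show ?thesis .
    qed
    have mu_pos: "0 < mu M Y x" using tail[OF x] mu by simp
    have "(1 + \<delta>) * (x * mu M Y x) < \<delta> * A_fun M Y x"
      using A x mu_pos assms(2) by (simp add: field_simps)
    then have "1 < 1 + \<delta> / x * A_fun M Y x - (1 + \<delta>) * mu M Y x"
      using x by (simp add: field_simps)
    also have "\<dots> = (\<integral>\<omega>. 1 + \<delta> / x * max (- x) (min x (real_of_int (Y \<omega>)))
        - (1 + \<delta>) * (if \<bar>real_of_int (Y \<omega>)\<bar> > x then 1 else 0) \<partial>M)"
    proof -
      have "integrable M (\<lambda>\<omega>. max (- x) (min x (real_of_int (Y \<omega>))))"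
        by (rule integrable_const_bound[where B = x]) (use x in auto)
      moreover have "integrable M (\<lambda>\<omega>. if \<bar>real_of_int (Y \<omega>)\<bar> > x then 1 else 0 :: real)"
        by (rule integrable_const_bound[where B = 1]) auto
      ultimately show ?thesis using mu_int by (simp add: A_fun_eq[OF x] prob_space)
    qed
    also have "\<dots> \<le> trunc_mgf (\<delta> / x) x"
      unfolding trunc_mgf_def
    proof (rule integral_mono)
      show "integrable M (\<lambda>\<omega>. 1 + \<delta> / x * max (- x) (min x (real_of_int (Y \<omega>)))
        - (1 + \<delta>) * (if \<bar>real_of_int (Y \<omega>)\<bar> > x then 1 else 0))"
        by (intro Bochner_Integration.integrable_diff Bochner_Integration.integrable_add
            integrable_mult_right; rule integrable_const_bound[where B = "1 + x"])
          (use x in auto)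
      show "integrable M (\<lambda>\<omega>. if real_of_int (Y \<omega>) \<le> x then exp (\<delta> / x * real_of_int (Y \<omega>)) else 0)"
        using x assms(2) by (intro integrable_trunc_mgf) auto
      fix \<omega>
      define t where "t = real_of_int (Y \<omega>) / x"
      have Yt: "real_of_int (Y \<omega>) = x * t" using x by (simp add: t_def)
      have "- x \<le> x * t \<longleftrightarrow> - 1 \<le> t" "x \<le> x * t \<longleftrightarrow> 1 \<le> t"
        using x mult_le_cancel_left_pos[of x "- 1" t] by simp_all
      then have "max (- x) (min x (x * t)) = x * max (- 1) (min 1 t)"
        using x by (auto simp: max_def min_def)
      then have "\<delta> / x * max (- x) (min x (x * t)) = \<delta> * max (- 1) (min 1 t)"
        using x by simp
      moreover have "\<bar>x * t\<bar> > x \<longleftrightarrow> \<bar>t\<bar> > 1" "x * t \<le> x \<longleftrightarrow> t \<le> 1"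
          "\<delta> / x * (x * t) = \<delta> * t"
        using x by (simp_all add: abs_mult)
      ultimately show "1 + \<delta> / x * max (- x) (min x (real_of_int (Y \<omega>)))
          - (1 + \<delta>) * (if \<bar>real_of_int (Y \<omega>)\<bar> > x then 1 else 0)
        \<le> (if real_of_int (Y \<omega>) \<le> x then exp (\<delta> / x * real_of_int (Y \<omega>)) else 0)"
        unfolding Yt using truncated_exp_lower_linear[of \<delta> t] assms(2) by (simp only: less_imp_le)
    qed
    finally show "1 < trunc_mgf (\<delta> / x) x" .
  qed
qed

text \<open>With t = Y / x in \<open>truncated_exp_lower_quadratic\<close> the linear term has mean
  0, leaving the gain (\<delta>/x)^2 m(x) / 2 against the loss (6/x) eta_+(x/2). The condition is
  therefore used at x/2 and transferred by monotonicity of m.\<close>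

lemma trunc_mgf_gt_1_CII:
  assumes "cond_CII M Y" and \<delta>: "0 < \<delta>" "\<delta> \<le> 1"
    and tail: "\<And>x. 0 < x \<Longrightarrow> 0 < measure M {\<omega> \<in> space M. \<bar>real_of_int (Y \<omega>)\<bar> > x}"
  shows "\<forall>\<^sub>F x in at_top. 1 < trunc_mgf (\<delta> / x) x"
proof -
  have int: "integrable M (\<lambda>\<omega>. real_of_int (Y \<omega>))" and mean: "(LINT \<omega>|M. real_of_int (Y \<omega>)) = 0"
    and lim: "((\<lambda>x. x * eta_plus M Y x / m_fun M Y x) \<longlongrightarrow> 0) at_top"
    using assms(1) by (auto simp: cond_CII_def)
  have int_sq: "integrable M (\<lambda>\<omega>. trunc_sq x \<bar>real_of_int (Y \<omega>)\<bar>)" if "0 < x" for x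
    by (rule Bochner_Integration.integrable_bound[where f = "\<lambda>\<omega>. x * \<bar>real_of_int (Y \<omega>)\<bar>"])
       (use int that trunc_sq_bounds in \<open>auto simp: abs_mult\<close>)
  have m_mono: "m_fun M Y x \<le> m_fun M Y y" if "0 < x" "x \<le> y" for x y
    using that int int_sq trunc_sq_mono by (simp add: m_fun_eq integral_mono)
  \<comment> \<open>On |Y| > x the Huber function is at least x^2 / 2; positivity of m is needed to
    clear the denominator.\<close>
  have m_pos: "0 < m_fun M Y x" if x: "0 < x" for x
  proof -
    have "0 < x\<^sup>2 / 2 * measure M {\<omega> \<in> space M. \<bar>real_of_int (Y \<omega>)\<bar> > x}"
      using x tail[OF x] by simp
    also have "\<dots> = (\<integral>\<omega>. x\<^sup>2 / 2 * indicator {\<omega> \<in> space M. \<bar>real_of_int (Y \<omega>)\<bar> > x} \<omega> \<partial>M)"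
      by simp
    also have "\<dots> \<le> (\<integral>\<omega>. trunc_sq x \<bar>real_of_int (Y \<omega>)\<bar> \<partial>M)"
    proof (intro integral_mono int_sq x)
      show "integrable M (\<lambda>\<omega>. x\<^sup>2 / 2 * indicator {\<omega> \<in> space M. \<bar>real_of_int (Y \<omega>)\<bar> > x} \<omega>)"
        by (intro integrable_mult_right integrable_real_indicator) (auto simp: emeasure_eq_measure)
      fix \<omega>
      have "x * x \<le> x * \<bar>real_of_int (Y \<omega>)\<bar>" if "x < \<bar>real_of_int (Y \<omega>)\<bar>"
        using that x by (intro mult_left_mono) auto
      then show "x\<^sup>2 / 2 * indicator {\<omega> \<in> space M. \<bar>real_of_int (Y \<omega>)\<bar> > x} \<omega> \<le> trunc_sq x \<bar>real_of_int (Y \<omega>)\<bar>"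
        using trunc_sq_bounds[OF x, of "\<bar>real_of_int (Y \<omega>)\<bar>"]
        by (auto simp: indicator_def trunc_sq_def power2_eq_square)
    qed
    finally show ?thesis by (simp add: m_fun_eq[OF x int])
  qed
  have half: "filterlim (\<lambda>x::real. x / 2) at_top at_top"
    using filterlim_tendsto_pos_mult_at_top[OF tendsto_const[of "1 / 2 :: real"] _ filterlim_ident]
    by simp
  \<comment> \<open>Multiplying the bound at x/2 by 12 / x^2 turns 1/24 into the 1/2 in front of m
    and gives the factor 6/x in front of eta_+.\<close>
  have "\<forall>\<^sub>F x in at_top. x * eta_plus M Y x / m_fun M Y x < \<delta>\<^sup>2 / 24"
    using \<delta> by (intro order_tendstoD(2)[OF lim]) simp
  then have "\<forall>\<^sub>F x in at_top. x / 2 * eta_plus M Y (x / 2) / m_fun M Y (x / 2) < \<delta>\<^sup>2 / 24"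
    by (rule eventually_compose_filterlim[OF _ half])
  then show ?thesis
    using eventually_gt_at_top[of 0]
  proof eventually_elim
    fix x :: real
    assume x: "0 < x" and e: "x / 2 * eta_plus M Y (x / 2) / m_fun M Y (x / 2) < \<delta>\<^sup>2 / 24"
    have "x / 2 * eta_plus M Y (x / 2) < \<delta>\<^sup>2 / 24 * m_fun M Y (x / 2)"
      using e m_pos[of "x / 2"] x by (simp add: field_simps)
    also have "\<dots> \<le> \<delta>\<^sup>2 / 24 * m_fun M Y x"
      using m_mono[of "x / 2" x] x by (intro mult_left_mono) auto
    finally have "6 / x * eta_plus M Y (x / 2) < (\<delta> / x)\<^sup>2 / 2 * m_fun M Y x"
      using x by (simp add: field_simps power2_eq_square)
    then have "1 < 1 + \<delta> / x * 0 + (\<delta> / x)\<^sup>2 / 2 * m_fun M Y x - 6 / x * eta_plus M Y (x / 2)"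
      by simp
    also have "\<dots> = (\<integral>\<omega>. 1 + \<delta> / x * real_of_int (Y \<omega>) + (\<delta> / x)\<^sup>2 / 2 * trunc_sq x \<bar>real_of_int (Y \<omega>)\<bar>
        - 6 / x * max 0 (real_of_int (Y \<omega>) - x / 2) \<partial>M)"
      using x int int_sq[OF x] mean by (simp add: m_fun_eq eta_plus_eq prob_space)
    also have "\<dots> \<le> trunc_mgf (\<delta> / x) x"
      unfolding trunc_mgf_def
    proof (rule integral_mono)
      show "integrable M (\<lambda>\<omega>. 1 + \<delta> / x * real_of_int (Y \<omega>) + (\<delta> / x)\<^sup>2 / 2 * trunc_sq x \<bar>real_of_int (Y \<omega>)\<bar>
        - 6 / x * max 0 (real_of_int (Y \<omega>) - x / 2))"
        using int int_sq[OF x] by simp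
      show "integrable M (\<lambda>\<omega>. if real_of_int (Y \<omega>) \<le> x then exp (\<delta> / x * real_of_int (Y \<omega>)) else 0)"
        using x \<delta> by (intro integrable_trunc_mgf) auto
      fix \<omega>
      define t where "t = real_of_int (Y \<omega>) / x"
      have Yt: "real_of_int (Y \<omega>) = x * t" using x by (simp add: t_def)
      have "x * \<bar>t\<bar> \<le> x \<longleftrightarrow> \<bar>t\<bar> \<le> 1" "x * t \<le> x \<longleftrightarrow> t \<le> 1"
        using x by simp_all
      then have "(\<delta> / x)\<^sup>2 / 2 * trunc_sq x \<bar>x * t\<bar> =
          \<delta>\<^sup>2 / 2 * (if \<bar>t\<bar> \<le> 1 then t\<^sup>2 / 2 else \<bar>t\<bar> - 1 / 2)"
        using x by (auto simp: trunc_sq_def abs_mult power_mult_distrib power2_eq_square field_simps)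
      moreover have "6 / x * max 0 (x * t - x / 2) = 6 * max 0 (t - 1 / 2)"
        "\<delta> / x * (x * t) = \<delta> * t" "x * t \<le> x \<longleftrightarrow> t \<le> 1"
        using x by (auto simp: max_def field_simps)
      ultimately show "1 + \<delta> / x * real_of_int (Y \<omega>) + (\<delta> / x)\<^sup>2 / 2 * trunc_sq x \<bar>real_of_int (Y \<omega>)\<bar>
        - 6 / x * max 0 (real_of_int (Y \<omega>) - x / 2)
        \<le> (if real_of_int (Y \<omega>) \<le> x then exp (\<delta> / x * real_of_int (Y \<omega>)) else 0)"
        unfolding Yt using truncated_exp_lower_quadratic[OF \<delta>, of t] by (simp only:)
    qed
    finally show "1 < trunc_mgf (\<delta> / x) x" .
  qed
qed

end

section \<open>The ladder height\<close>

context step_law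
begin

lemma overshoot_tendsto_0:
  assumes "\<And>\<delta>. 0 < \<delta> \<Longrightarrow> \<delta> \<le> 1 \<Longrightarrow>
    \<forall>\<^sub>F n in sequentially. 1 < (\<integral>k. indicator {..int n} k * exp (\<delta> / real n * real_of_int k) \<partial>D)"
  shows "(\<lambda>n. overshoot n n) \<longlonglongrightarrow> 0"
proof (rule order_tendstoI)
  fix a :: real assume "a < 0"
  moreover have "0 \<le> overshoot n n" for n
    unfolding overshoot_def using passage_lim_bounds(2)[of "int n" "{..int (n + n)}"] by simp
  ultimately show "\<forall>\<^sub>F n in sequentially. a < overshoot n n"
    by (intro always_eventually) (auto intro: less_le_trans)
next
  fix a :: real assume "0 < a"
  \<comment> \<open>The final bound is 1 - exp(-2 \<delta>) <= 2 \<delta> <= a/2; the cap 1 keeps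
    \<delta> in the range of the assumption.\<close>
  define \<delta> where "\<delta> = min 1 (a / 4)"
  have \<delta>: "0 < \<delta>" "\<delta> \<le> 1" "2 * \<delta> < a" using \<open>0 < a\<close> by (auto simp: \<delta>_def)
  show "\<forall>\<^sub>F n in sequentially. overshoot n n < a"
    using assms[OF \<delta>(1,2)] eventually_gt_at_top[of 0]
  proof eventually_elim
    fix n :: nat
    assume n: "1 < (\<integral>k. indicator {..int n} k * exp (\<delta> / real n * real_of_int k) \<partial>D)" "0 < n"
    have "overshoot n n \<le> 1 - exp (- (2 * (\<delta> / real n) * real n))"
      using n \<delta> by (intro overshoot_le) auto
    also have "\<dots> = 1 - exp (- (2 * \<delta>))" using n by simp
    also have "\<dots> \<le> 2 * \<delta>" using exp_ge_add_one_self[of "- (2 * \<delta>)"] by simp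
    finally show "overshoot n n < a" using \<delta> by simp
  qed
qed

text \<open>\<open>renewal_lower_bound\<close> controls q at 2m, so j is replaced by m = j div 2:
  then 2m <= j and j + 1 <= 2 (m + 1), at the cost of a factor 2. Only here is the window t set
  equal to the level m.\<close>

lemma ladder_tail_tendsto_0:
  assumes lim: "(\<lambda>n. overshoot n n) \<longlonglongrightarrow> 0"
  shows "(\<lambda>j. (real j + 1) * (1 - ladder_cdf j) / (\<Sum>k\<le>j. 1 - ladder_cdf k)) \<longlonglongrightarrow> 0"
proof (rule tendsto_sandwich[OF _ _ tendsto_const])
  let ?L = "\<lambda>j. \<Sum>k\<le>j. 1 - ladder_cdf k"
  have L1: "1 \<le> ?L j" for j
    using member_le_sum[of 0 "{..j}" "\<lambda>k. 1 - ladder_cdf k"] by (simp add: ladder_cdf_0 ladder_cdf_le_1)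
  have nn: "0 \<le> overshoot n n" for n
    unfolding overshoot_def using passage_lim_bounds(2)[of "int n" "{..int (n + n)}"] by simp
  have "filterlim (\<lambda>j::nat. j div 2) at_top sequentially"
    unfolding filterlim_at_top
  proof
    fix Z :: nat
    show "\<forall>\<^sub>F j in sequentially. Z \<le> j div 2"
      using eventually_ge_at_top[of "2 * Z"] by eventually_elim linarith
  qed
  from tendsto_mult_right_zero[OF filterlim_compose[OF lim this], of 2]
  show "(\<lambda>j. 2 * overshoot (j div 2) (j div 2)) \<longlonglongrightarrow> 0" .
  have "(real j + 1) * (1 - ladder_cdf j) / ?L j \<le> 2 * overshoot (j div 2) (j div 2)" for j
  proof -
    let ?m = "j div 2"
    have "(real j + 1) * (1 - ladder_cdf j) \<le> (2 * (real ?m + 1)) * (1 - ladder_cdf (?m + ?m))"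
    proof (intro mult_mono)
      have "j + 1 \<le> 2 * (?m + 1)" by presburger
      then have "real (j + 1) \<le> real (2 * (?m + 1))" by (simp only: of_nat_le_iff)
      then show "real j + 1 \<le> 2 * (real ?m + 1)" by simp
      have "ladder_cdf (?m + ?m) \<le> ladder_cdf j" by (intro monoD[OF mono_ladder_cdf]) linarith
      then show "1 - ladder_cdf j \<le> 1 - ladder_cdf (?m + ?m)" by simp
    qed (auto simp: ladder_cdf_le_1)
    also have "\<dots> = 2 * ((real ?m + 1) * (1 - ladder_cdf (?m + ?m)))" by simp
    also have "\<dots> \<le> 2 * (overshoot ?m ?m * ?L ?m)"
      using renewal_lower_bound[of ladder_cdf "overshoot ?m" ?m ?m]
        ladder_cdf_0 mono_ladder_cdf ladder_cdf_le_1 overshoot_renewal by simp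
    also have "\<dots> \<le> 2 * (overshoot ?m ?m * ?L j)"
      using nn by (intro mult_left_mono sum_mono2) (auto simp: ladder_cdf_le_1)
    finally show ?thesis using L1[of j] by (simp add: field_simps)
  qed
  then show "\<forall>\<^sub>F j in sequentially. (real j + 1) * (1 - ladder_cdf j) / ?L j \<le> 2 * overshoot (j div 2) (j div 2)"
    by simp
  have "0 \<le> (real j + 1) * (1 - ladder_cdf j) / ?L j" for j
    using L1[of j] by (intro divide_nonneg_nonneg mult_nonneg_nonneg) (auto simp: ladder_cdf_le_1)
  then show "\<forall>\<^sub>F j in sequentially. 0 \<le> (real j + 1) * (1 - ladder_cdf j) / ?L j" by simp
qed

end

section \<open>Passage events on path space\<close>

text \<open>The pathwise event behind \<open>passage\<close>, with the same recursion, so that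
  probabilities can be matched by induction on n.\<close>

primrec hits :: "int \<Rightarrow> int set \<Rightarrow> nat \<Rightarrow> int \<Rightarrow> (nat \<Rightarrow> int) \<Rightarrow> bool" where
  "hits x A 0 y \<xi> = False"
| "hits x A (Suc n) y \<xi> =
     (if x < y + \<xi> 0 then y + \<xi> 0 \<in> A else hits x A n (y + \<xi> 0) (\<lambda>i. \<xi> (Suc i)))"

text \<open>Unrolls the recursion into the first index above x, the form in which the ladder time is
  recognised.\<close>

lemma hits_iff:
  "hits x A n y \<xi> \<longleftrightarrow> (\<exists>k\<in>{1..n}. x < y + (\<Sum>i<k. \<xi> i) \<and> y + (\<Sum>i<k. \<xi> i) \<in> A
     \<and> (\<forall>l\<in>{1..<k}. y + (\<Sum>i<l. \<xi> i) \<le> x))"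
proof (induction n arbitrary: y \<xi>)
  case (Suc n)
  define s where "s k = y + (\<Sum>i<k. \<xi> i)" for k
  define P where "P k \<longleftrightarrow> x < s k \<and> s k \<in> A \<and> (\<forall>l\<in>{1..<k}. s l \<le> x)" for k
  have s1: "s 1 = y + \<xi> 0" by (simp add: s_def)
  have s: "s 1 + (\<Sum>i<k. \<xi> (Suc i)) = s (Suc k)" for k
    unfolding s1 by (simp only: s_def sum.lessThan_Suc_shift add.assoc)
  have "{1..Suc n} = insert 1 (Suc ` {1..n})"
    by (auto simp: image_Suc_atLeastAtMost)
  then have split: "(\<exists>k\<in>{1..Suc n}. P k) \<longleftrightarrow> P 1 \<or> (\<exists>k\<in>{1..n}. P (Suc k))"
    by (simp only:) blast
  have P1: "P 1 \<longleftrightarrow> x < s 1 \<and> s 1 \<in> A" by (simp add: P_def)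
  have P_Suc: "P (Suc k) \<longleftrightarrow> \<not> x < s 1 \<and>
      (x < s (Suc k) \<and> s (Suc k) \<in> A \<and> (\<forall>l\<in>{1..<k}. s (Suc l) \<le> x))" if "k \<in> {1..n}" for k
  proof -
    have "{1..<Suc k} = insert 1 (Suc ` {1..<k})"
      using that by (auto simp: image_Suc_atLeastLessThan)
    then have "(\<forall>l\<in>{1..<Suc k}. s l \<le> x) \<longleftrightarrow> s 1 \<le> x \<and> (\<forall>l\<in>{1..<k}. s (Suc l) \<le> x)"
      by (simp only:) blast
    then show ?thesis unfolding P_def not_less by blast
  qed
  have "hits x A (Suc n) y \<xi> \<longleftrightarrow> (\<exists>k\<in>{1..Suc n}. P k)"
    unfolding hits.simps Suc.IH s1[symmetric] s split P1 using P_Suc by auto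
  then show ?case by (simp only: P_def s_def)
qed simp

lemma hits_mono: "m \<le> n \<Longrightarrow> hits x A m y \<xi> \<Longrightarrow> hits x A n y \<xi>"
  unfolding hits_iff by (meson atLeastAtMost_iff order_trans)

context step_law
begin

sublocale sequence_space D ..

lemma measurable_shift [measurable]: "(\<lambda>\<xi> i. \<xi> (Suc i)) \<in> measurable S S"
  by (intro measurable_PiM_single') (auto simp: space_PiM PiE_iff extensional_def)

lemma measurable_hits [measurable]: "Measurable.pred S (hits x A n y)"
proof (induction n arbitrary: y)
  case (Suc n)
  let ?f = "\<lambda>k \<xi>. if x < y + k then y + k \<in> A else hits x A n (y + k) (\<lambda>i. \<xi> (Suc i))"
  have "(\<lambda>\<xi>. ?f (\<xi> 0) \<xi>) \<in> measurable S (count_space UNIV)"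
  proof (rule measurable_compose_countable[where f = ?f and g = "\<lambda>\<xi>. \<xi> 0"])
    show "(\<lambda>\<xi>. if x < y + k then y + k \<in> A else hits x A n (y + k) (\<lambda>i. \<xi> (Suc i)))
      \<in> measurable S (count_space UNIV)" for k
      using measurable_compose[OF measurable_shift Suc] by simp
    show "(\<lambda>\<xi>. \<xi> 0) \<in> measurable S (count_space UNIV)"
      using measurable_component_singleton[of 0 UNIV "\<lambda>_. D"]
      by (simp add: measurable_cong_sets[OF refl sets_D])
  qed
  then show ?case by (simp only: hits.simps)
next
  case 0
  have "hits x A 0 y = (\<lambda>_. False)" by (simp add: fun_eq_iff)
  then show ?case by simp
qed

text \<open>Under the product law the first step and the shifted path are independent with laws D
  and S (\<open>PiM_iter\<close>); Fubini then reproduces the recursion of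
  \<open>passage\<close>.\<close>

lemma prob_hits: "measure S {\<xi> \<in> space S. hits x A n y \<xi>} = passage D x A n y"
proof (induction n arbitrary: y)
  case (Suc n)
  interpret DS: pair_prob_space D S ..
  define E where "E = {\<xi> \<in> space S. hits x A (Suc n) y \<xi>}"
  let ?f = "\<lambda>\<xi>. indicator E \<xi> :: real"
  have sp: "space S = UNIV" by (auto simp: space_PiM)
  have E [measurable]: "E \<in> sets S"
    unfolding E_def using measurable_hits by (simp only: pred_def)
  have E_case: "case_nat k \<xi> \<in> E \<longleftrightarrow> (if x < y + k then y + k \<in> A else hits x A n (y + k) \<xi>)" for k \<xi>
    by (simp add: E_def sp)
  have cn: "(\<lambda>(k, \<xi>). case_nat k \<xi>) \<in> measurable (D \<Otimes>\<^sub>M S) S"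
    by measurable
  have f [measurable]: "?f \<in> borel_measurable S" by simp
  have "measure S E = (\<integral>\<xi>. ?f \<xi> \<partial>S)"
    by simp
  also have "\<dots> = (\<integral>\<xi>. ?f \<xi> \<partial>distr (D \<Otimes>\<^sub>M S) S (\<lambda>(k, \<xi>). case_nat k \<xi>))"
    by (simp only: PiM_iter)
  also have "\<dots> = (\<integral>p. ?f ((\<lambda>(k, \<xi>). case_nat k \<xi>) p) \<partial>(D \<Otimes>\<^sub>M S))"
    by (rule integral_distr[OF cn f])
  also have "\<dots> = (\<integral>k. (\<integral>\<xi>. ?f (case_nat k \<xi>) \<partial>S) \<partial>D)"
  proof -
    have "integrable (D \<Otimes>\<^sub>M S) (\<lambda>p. ?f ((\<lambda>(k, \<xi>). case_nat k \<xi>) p))"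
      by (rule DS.integrable_const_bound[where B = 1, OF _ measurable_compose[OF cn f]])
        (simp add: indicator_def)
    from DS.integral_fst'[OF this] show ?thesis by (simp only: case_prod_conv)
  qed
  also have "\<dots> = (\<integral>k. (if x < y + k then indicator A (y + k) else passage D x A n (y + k)) \<partial>D)"
  proof (rule Bochner_Integration.integral_cong[OF refl])
    fix k
    show "(\<integral>\<xi>. ?f (case_nat k \<xi>) \<partial>S) =
        (if x < y + k then indicator A (y + k) else passage D x A n (y + k))"
    proof (cases "x < y + k")
      case True
      have "(\<integral>\<xi>. ?f (case_nat k \<xi>) \<partial>S) = (\<integral>\<xi>. indicator A (y + k) \<partial>S)"
        by (intro Bochner_Integration.integral_cong) (use True in \<open>auto simp: indicator_def E_case sp\<close>)
      then show ?thesis using True P.prob_space by simp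
    next
      case False
      have "(\<integral>\<xi>. ?f (case_nat k \<xi>) \<partial>S) =
          (\<integral>\<xi>. indicator {\<xi> \<in> space S. hits x A n (y + k) \<xi>} \<xi> \<partial>S)"
        by (intro Bochner_Integration.integral_cong) (use False in \<open>auto simp: indicator_def E_case sp\<close>)
      then show ?thesis using False Suc[of "y + k"] by simp
    qed
  qed
  finally show ?case by (simp only: E_def passage.simps)
qed simp

end

lemma ladder_time_eq:
  "ladder_time X \<omega> = (if \<exists>n\<ge>1. walk X n \<omega> > 0 then enat (LEAST n. n \<ge> 1 \<and> walk X n \<omega> > 0) else \<infinity>)"
proof (cases "\<exists>n\<ge>1. walk X n \<omega> > 0")
  case True
  let ?P = "\<lambda>n. n \<ge> 1 \<and> walk X n \<omega> > 0"
  have L: "?P (LEAST n. ?P n)" by (rule LeastI_ex) (use True in auto)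
  have "ladder_time X \<omega> = enat (LEAST n. ?P n)"
    unfolding ladder_time_def
  proof (rule antisym)
    show "(INF n\<in>Collect ?P. enat n) \<le> enat (LEAST n. ?P n)"
      by (rule INF_lower) (use L in simp)
    show "enat (LEAST n. ?P n) \<le> (INF n\<in>Collect ?P. enat n)"
      by (rule INF_greatest) (simp add: Least_le)
  qed
  then show ?thesis using True by auto
next
  case False
  then have "{n. n \<ge> 1 \<and> walk X n \<omega> > 0} = {}" by auto
  then have "ladder_time X \<omega> = \<infinity>" by (simp only: ladder_time_def image_empty Inf_empty top_enat_def)
  then show ?thesis using False by auto
qed

lemma ladder_height_cases:
  "ladder_height X \<omega> = \<infinity> \<or> (\<exists>k::nat. ladder_height X \<omega> = ereal (real k))" (is ?A)
  "0 < ladder_height X \<omega>" (is ?B)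
  "ladder_height X \<omega> \<le> ereal (real j) \<longleftrightarrow> (\<exists>n. hits 0 {..int j} n 0 (\<lambda>i. X (Suc i) \<omega>))" (is ?C)
proof -
  let ?P = "\<lambda>n. n \<ge> 1 \<and> walk X n \<omega> > 0"
  \<comment> \<open>Paths are indexed from 0 but the walk starts with the step
    \<open>X 1\<close>.\<close>
  have w: "(\<Sum>i<k. X (Suc i) \<omega>) = walk X k \<omega>" for k
    unfolding walk_def by (rule sum.reindex_bij_witness[of _ "\<lambda>i. i - 1" Suc]) auto
  have h: "(\<exists>n. hits 0 {..int j} n 0 (\<lambda>i. X (Suc i) \<omega>)) \<longleftrightarrow>
      (\<exists>k. ?P k \<and> walk X k \<omega> \<le> int j \<and> (\<forall>l<k. \<not> ?P l))"
  proof -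
    define Q where "Q k \<longleftrightarrow> 0 < walk X k \<omega> \<and> walk X k \<omega> \<le> int j \<and> (\<forall>l\<in>{1..<k}. walk X l \<omega> \<le> 0)" for k
    have "(\<exists>n. hits 0 {..int j} n 0 (\<lambda>i. X (Suc i) \<omega>)) \<longleftrightarrow> (\<exists>n. \<exists>k\<in>{1..n}. Q k)"
      unfolding hits_iff w Q_def by simp
    also have "\<dots> \<longleftrightarrow> (\<exists>k\<ge>1. Q k)"
      by (meson atLeastAtMost_iff order_refl)
    also have "(\<forall>l\<in>{1..<k}. walk X l \<omega> \<le> 0) \<longleftrightarrow> (\<forall>l<k. \<not> ?P l)" for k
      by (auto simp: not_less)
    then have "(\<exists>k\<ge>1. Q k) \<longleftrightarrow> (\<exists>k. ?P k \<and> walk X k \<omega> \<le> int j \<and> (\<forall>l<k. \<not> ?P l))"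
      unfolding Q_def by blast
    finally show ?thesis .
  qed
  have "?A \<and> ?B \<and> ?C"
  proof (cases "\<exists>n\<ge>1. walk X n \<omega> > 0")
    case True
    define T where "T = (LEAST n. ?P n)"
    have T: "?P T" unfolding T_def by (rule LeastI_ex) (use True in auto)
    have T_le: "\<not> ?P l" if "l < T" for l using that not_less_Least unfolding T_def by blast
    have Z: "ladder_height X \<omega> = ereal (of_int (walk X T \<omega>))"
      using True by (simp add: ladder_height_def ladder_time_eq T_def)
    have "(\<exists>k. ?P k \<and> walk X k \<omega> \<le> int j \<and> (\<forall>l<k. \<not> ?P l)) \<longleftrightarrow> walk X T \<omega> \<le> int j"
    proof
      assume "\<exists>k. ?P k \<and> walk X k \<omega> \<le> int j \<and> (\<forall>l<k. \<not> ?P l)"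
      then obtain k where k: "?P k" "walk X k \<omega> \<le> int j" "\<forall>l<k. \<not> ?P l" by blast
      then have "k = T" using T T_le by (meson linorder_neqE_nat)
      with k show "walk X T \<omega> \<le> int j" by simp
    qed (use T T_le in blast)
    moreover have "real_of_int (walk X T \<omega>) \<le> real j \<longleftrightarrow> walk X T \<omega> \<le> int j"
      by linarith
    ultimately have ?C
      unfolding h Z by (simp only: ereal_less_eq)
    moreover have "ladder_height X \<omega> = ereal (real (nat (walk X T \<omega>)))"
      using T unfolding Z by simp
    moreover have ?B
      using T unfolding Z by simp
    ultimately show ?thesis
      by blast
  next
    case False
    then have Z: "ladder_height X \<omega> = \<infinity>"
      by (simp add: ladder_height_def ladder_time_eq)
    show ?thesis using False unfolding h Z by auto
  qed
  then show ?A ?B ?C by auto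
qed

section \<open>The law of the ladder height\<close>

locale iid_walk = prob_space M for M :: "'a measure" +
  fixes X :: "nat \<Rightarrow> 'a \<Rightarrow> int"
  assumes iid: "iid M X"
begin

definition D where "D = distr M (count_space UNIV) (X 0)"

lemma measurable_X [measurable]: "X n \<in> measurable M (count_space UNIV)"
  using iid unfolding iid_def indep_vars_def2 by blast

sublocale D: step_law D
proof (rule step_law.intro)
  show "prob_space D"
    unfolding D_def by (rule prob_space_distr) (rule measurable_X)
  show "step_law_axioms D"
    by (rule step_law_axioms.intro) (simp add: D_def)
qed

sublocale integer_rv M "X 0"
  by unfold_locales (rule measurable_X)

lemma measurable_steps: "(\<lambda>\<omega> i. X (f i) \<omega>) \<in> measurable M D.S"
proof (rule measurable_PiM_single')
  show "(\<lambda>\<omega>. X (f i) \<omega>) \<in> measurable M D" for i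
    using measurable_X by (simp only: measurable_cong_sets[OF refl D.sets_D])
qed (simp only: D.space_D PiE_UNIV_domain Pi_UNIV UNIV_I Pi_I)

text \<open>The full sequence including \<open>X 0\<close> has the product law; the steps are its
  image under the shift, which preserves that law because \<open>Suc\<close> is injective.\<close>

lemma distr_steps: "distr M D.S (\<lambda>\<omega> i. X (Suc i) \<omega>) = D.S"
proof -
  have "indep_vars (\<lambda>_. count_space UNIV) X UNIV"
    using iid unfolding iid_def by blast
  then have "distr M (\<Pi>\<^sub>M i\<in>UNIV. count_space UNIV) (\<lambda>\<omega>. \<lambda>i\<in>UNIV. X i \<omega>) =
      (\<Pi>\<^sub>M i\<in>UNIV. distr M (count_space UNIV) (X i))"
    by (rule iffD1[OF indep_vars_iff_distr_eq_PiM[OF UNIV_not_empty measurable_X]])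
  also have "(\<Pi>\<^sub>M i\<in>UNIV. distr M (count_space UNIV) (X i)) = D.S"
    using iid unfolding iid_def D_def by (intro PiM_cong) blast+
  finally have X: "distr M D.S (\<lambda>\<omega> i. X i \<omega>) = D.S"
    by (subst distr_cong[OF refl, of _ "\<Pi>\<^sub>M i\<in>UNIV. count_space UNIV"])
       (auto simp: restrict_UNIV intro!: sets_PiM_cong D.sets_D)
  have "distr M D.S (\<lambda>\<omega> i. X (Suc i) \<omega>) = distr (distr M D.S (\<lambda>\<omega> i. X i \<omega>)) D.S (\<lambda>\<xi> i. \<xi> (Suc i))"
    by (subst distr_distr[OF D.measurable_shift measurable_steps[of "\<lambda>i. i"]]) (simp add: comp_def)
  also have "\<dots> = distr D.S D.S (\<lambda>\<xi>. \<lambda>i\<in>UNIV. \<xi> (Suc i))"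
    unfolding X by (simp add: restrict_UNIV)
  also have "\<dots> = D.S"
    using D.step_law_axioms by (intro distr_PiM_reindex) (auto simp: step_law_def)
  finally show ?thesis .
qed

lemma measurable_ladder_height [measurable]: "ladder_height X \<in> borel_measurable M"
proof -
  have walk [measurable]: "walk X n \<in> measurable M (count_space UNIV)" for n
  proof (induction n)
    case 0
    then show ?case by (simp add: walk_def[abs_def])
  next
    case (Suc n)
    have "(\<lambda>\<omega>. (\<lambda>k \<omega>. k + X (Suc n) \<omega>) (walk X n \<omega>) \<omega>) \<in> measurable M (count_space UNIV)"
    proof (rule measurable_compose_countable[OF _ Suc])
      show "(\<lambda>\<omega>. k + X (Suc n) \<omega>) \<in> measurable M (count_space UNIV)" for k
        using measurable_compose[OF measurable_X, of "\<lambda>i. k + i"] by simp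
    qed
    then show ?case by (simp add: walk_def[abs_def])
  qed
  have T: "ladder_time X \<in> measurable M (count_space UNIV)"
  proof -
    let ?P = "\<lambda>n \<omega>. n \<ge> 1 \<and> walk X n \<omega> > 0"
    have P: "Measurable.pred M (?P n)" for n
      using measurable_compose[OF walk[of n], of "\<lambda>k. n \<ge> 1 \<and> k > 0"] by simp
    have "(\<lambda>\<omega>. LEAST n. ?P n \<omega>) \<in> measurable M (count_space UNIV)"
      by (rule measurable_Least) (rule P)
    then have "(\<lambda>\<omega>. enat (LEAST n. ?P n \<omega>)) \<in> measurable M (count_space UNIV)"
      by (rule measurable_compose) simp
    moreover have "Measurable.pred M (\<lambda>\<omega>. \<exists>n. ?P n \<omega>)"
      by (rule pred_intros_countable(2)) (rule P)
    ultimately have "(\<lambda>\<omega>. if \<exists>n. ?P n \<omega> then enat (LEAST n. ?P n \<omega>) else \<infinity>) \<in> measurable M (count_space UNIV)"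
      by (intro measurable_If) (simp_all only: pred_def measurable_const space_count_space UNIV_I)
    then show ?thesis
      by (simp only: ladder_time_eq[abs_def])
  qed
  have "(\<lambda>\<omega>. (\<lambda>t \<omega>. case t of enat n \<Rightarrow> ereal (of_int (walk X n \<omega>)) | \<infinity> \<Rightarrow> \<infinity>) (ladder_time X \<omega>) \<omega>)
      \<in> borel_measurable M"
  proof (rule measurable_compose_countable[OF _ T])
    fix t :: enat
    show "(\<lambda>\<omega>. case t of enat n \<Rightarrow> ereal (of_int (walk X n \<omega>)) | \<infinity> \<Rightarrow> \<infinity>) \<in> borel_measurable M"
      by (cases t) auto
  qed
  then show ?thesis by (simp add: ladder_height_def[abs_def])
qed

text \<open>The event is the increasing union over n of passage within n steps. Whatever mass
  \<open>ladder_cdf\<close> lacks in the limit sits at Z = infinity.\<close>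

lemma prob_ladder_height_le: "measure M {\<omega> \<in> space M. ladder_height X \<omega> \<le> ereal (real j)} = D.ladder_cdf j"
proof -
  let ?E = "\<lambda>n. {\<omega> \<in> space M. hits 0 {..int j} n 0 (\<lambda>i. X (Suc i) \<omega>)}"
  note m = measurable_steps[of Suc]
  have E: "measure M (?E n) = passage D 0 {..int j} n 0" for n
  proof -
    have "measure M (?E n) = measure (distr M D.S (\<lambda>\<omega> i. X (Suc i) \<omega>)) {\<xi> \<in> space D.S. hits 0 {..int j} n 0 \<xi>}"
      using m by (subst measure_distr)
        (auto intro!: arg_cong[where f = "measure M"] dest: measurable_space)
    then show ?thesis by (simp add: distr_steps D.prob_hits)
  qed
  have "(\<lambda>n. measure M (?E n)) \<longlonglongrightarrow> measure M (\<Union>n. ?E n)"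
  proof (rule finite_Lim_measure_incseq)
    show "range ?E \<subseteq> sets M"
      using measurable_compose[OF m D.measurable_hits] by (auto simp: pred_def)
    show "incseq ?E"
      using hits_mono by (auto simp: incseq_def)
  qed
  then have "measure M (\<Union>n. ?E n) = D.ladder_cdf j"
    unfolding D.ladder_cdf_def E by (rule LIMSEQ_unique[OF _ D.LIMSEQ_passage])
  moreover have "(\<Union>n. ?E n) = {\<omega> \<in> space M. ladder_height X \<omega> \<le> ereal (real j)}"
    by (auto simp: ladder_height_cases(3))
  ultimately show ?thesis by simp
qed

text \<open>The common end of both cases: each condition enters only through the truncated
  exponential moment.\<close>

lemma relatively_stable_ladder_height:
  assumes "\<And>\<delta>. 0 < \<delta> \<Longrightarrow> \<delta> \<le> 1 \<Longrightarrow> \<forall>\<^sub>F x in at_top. 1 < trunc_mgf (\<delta> / x) x"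
  shows "relatively_stable M (ladder_height X)"
proof -
  have mgf: "(\<integral>k. indicator {..int n} k * exp (\<theta> * real_of_int k) \<partial>D) = trunc_mgf \<theta> (real n)" for n \<theta>
    unfolding D_def trunc_mgf_def
    by (subst integral_distr) (auto intro!: Bochner_Integration.integral_cong simp: indicator_def of_int_le_iff)
  have "(\<lambda>n. D.overshoot n n) \<longlonglongrightarrow> 0"
  proof (rule D.overshoot_tendsto_0)
    fix \<delta> :: real assume "0 < \<delta>" "\<delta> \<le> 1"
    from eventually_compose_filterlim[OF assms[OF this] filterlim_real_sequentially]
    show "\<forall>\<^sub>F n in sequentially. 1 < (\<integral>k. indicator {..int n} k * exp (\<delta> / real n * real_of_int k) \<partial>D)"
      by (simp only: mgf)
  qed
  then have lim: "(\<lambda>j. (real j + 1) * (1 - D.ladder_cdf j) / (\<Sum>k\<le>j. 1 - D.ladder_cdf k)) \<longlonglongrightarrow> 0"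
    by (rule D.ladder_tail_tendsto_0)
  have tail: "measure M {\<omega> \<in> space M. ereal (real j) < ladder_height X \<omega>} = 1 - D.ladder_cdf j" for j
  proof -
    have "{\<omega> \<in> space M. ereal (real j) < ladder_height X \<omega>} =
        space M - {\<omega> \<in> space M. ladder_height X \<omega> \<le> ereal (real j)}"
      by auto
    then show ?thesis
      using prob_compl[of "{\<omega> \<in> space M. ladder_height X \<omega> \<le> ereal (real j)}"]
      by (simp add: prob_ladder_height_le)
  qed
  show ?thesis
  proof (rule relatively_stable_if_tail)
    show "AE \<omega> in M. ladder_height X \<omega> = \<infinity> \<or> (\<exists>k::nat. ladder_height X \<omega> = ereal (real k))"
      using ladder_height_cases(1) by (intro always_eventually allI)
    show "measure M {\<omega> \<in> space M. ereal (real 0) < ladder_height X \<omega>} = 1"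
      unfolding tail D.ladder_cdf_0 by simp
    show "(\<lambda>j. (real j + 1) * measure M {\<omega> \<in> space M. ereal (real j) < ladder_height X \<omega>} /
        (\<Sum>k\<le>j. measure M {\<omega> \<in> space M. ereal (real k) < ladder_height X \<omega>})) \<longlonglongrightarrow> 0"
      unfolding tail by (rule lim)
  qed (rule prob_space_axioms measurable_ladder_height)+
qed

end

theorem proposition40:
  fixes M :: "'a measure" and X :: "nat \<Rightarrow> 'a \<Rightarrow> int"
  assumes "prob_space M"
    and "iid M X"
    and "irreducible_walk M X"
    and "measure M {\<omega> \<in> space M. X 0 \<omega> \<ge> 2} > 0"
    and "\<And>x :: real. x > 0 \<Longrightarrow> measure M {\<omega> \<in> space M. \<bar>real_of_int (X 0 \<omega>)\<bar> > x} > 0"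
  shows "(cond_CI M (X 0) \<longrightarrow> relatively_stable M (ladder_height X)) \<and>
         ((\<integral>\<^sup>+ \<omega>. ennreal ((real_of_int (X 0 \<omega>))\<^sup>2) \<partial>M) = \<infinity> \<and> cond_CII M (X 0) \<longrightarrow>
            relatively_stable M (ladder_height X))"
proof -
  interpret iid_walk M X
    using assms(1,2) by (simp add: iid_walk_def iid_walk_axioms_def)
  show ?thesis
    using relatively_stable_ladder_height trunc_mgf_gt_1_CI trunc_mgf_gt_1_CII assms(5) by blast
qed

end
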